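(* Let $u\in L^2([0,T]\times\mathbb{T}^3_L)$ be an incompressible vector field (i.e. $\nabla_x\cdot u=0$ in the sense of distributions) with $\overline{\varepsilon}=\sup_{q}\lambda_q\langle|u_q|^3\rangle<\infty$, and let $\underline{\varepsilon}=\inf_{q}\langle|\pi_q|\rangle$. Then the averaged energy spectrum satisfies the two-sided bound $$\underline{\varepsilon}^{2/3}\ \lesssim\ \sum_{p\ge0}K_{q-p}^{2/3}\,\lambda_p^{5/3}(L\lambda_p)^{1-\frac{D_p}{3}}E_p\ \lesssim\ \overline{\varepsilon}^{2/3}\qquad\text{for all }q\ge1,$$ where $K_j=2^{-2|j|/3}$, $j\in\mathbb{Z}$, and the implied constants are absolute (independent of $u,q,L,T$).
   Context: **Setting.** $L,T>0$; $\mathbb{T}^3_L$ is the three-dimensional torus of side length $L$; $\Omega_T=[0,T]\times\mathbb{T}^3_L$; $\langle f\rangle=\frac{1}{TL^3}\int_{\Omega_T}f\,dx\,dt$. **Littlewood-Paley decomposition.** Fix a nonnegative radial $\chi\in C_0^\infty(B(0,1))$ on $\mathbb{R}^3$ with $\chi(\xi)=1$ for $|\xi|\le 1/2$, and $\phi(\xi)=\chi(\xi/2)-\chi(\xi)$. Let $\varphi_{-1}(\xi)=\chi(L\xi)$, $\varphi_q(\xi)=\phi(L\xi/2^q)$ for $q\ge 0$. With Fourier coefficients $\mathcal F(u)(k)=L^{-3}\int_{\mathbb{T}^3_L}u(x)e^{-2\pi i k\cdot x}dx$, $k\in\frac1L\mathbb{Z}^3$, set $u_q=\sum_{k\in\frac1L\mathbb{Z}^3}\varphi_q(k)\mathcal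 F(u)(k)e^{2\pi i k\cdot x}$ (acting in the space variable), so $u=\sum_{q\ge-1}u_q$. Put $\lambda_q=2^q/L$. The function $\chi$ is fixed once and for all. **Flux density.** For $q\ge1$, $$\pi_q=\sum_{\substack{p'\ge q-1,\ p''\ge q,\ p'''<q\\|p'-p''|<2}}(u_{p'}\otimes u_{p''}):\nabla u_{p'''},\qquad (a\otimes b):\nabla v=\sum_{i,j}a_ib_j\partial_iv_j .$$ The supremum defining $\overline\varepsilon$ is over $q\ge0$, the infimum defining $\underline\varepsilon$ is over $q\ge1$. **Spectrum, active volumes, dimensions.** $E_q=\dfrac{\langle|u_q|^2\rangle}{\lambda_q}$ and $V_q=L^3\dfrac{\langle|u_q|^2\rangle^3}{\langle|u_q|^3\rangle^2}$ for $q\ge0$; $D_q=3-\dfrac{\log_2(L^3/V_q)}{q}$ for $q\ge1$, equivalently $V_q=L^{D_q}\lambda_q^{D_q-3}$, so that $(L\lambda_q)^{1-D_q/3}=LV_q^{-1/3}$. For $q=0$ the factor $(L\lambda_0)^{1-D_0/3}$ is read as $LV_0^{-1/3}$. If $u_p=0$ a.e., the $p$-th term of the sum is read as $0$. *)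

theory Defs
  imports "HOL-Analysis.Analysis"
begin

text \<open>
  The torus of side length L is represented by its fundamental cell. A field on the
  torus enters only through integrals over the cell, so no periodicity is imposed on it
  (opposite faces are null sets); its Littlewood-Paley blocks are L-periodic trigonometric
  polynomials on the whole space. Space-time points are pairs (t, x).
\<close>

definition torus_cell :: "real \<Rightarrow> (real^3) set" where
  "torus_cell L = cbox 0 (vec L)"

definition spacetime :: "real \<Rightarrow> real \<Rightarrow> (real \<times> (real^3)) set" where
  "spacetime L T = {0..T} \<times> torus_cell L"

text \<open>Averages are taken of nonnegative functions only; being extended-real valued,
  they do not silently vanish when the integral diverges.\<close>

definition avg :: "real \<Rightarrow> real \<Rightarrow> (real \<times> (real^3) \<Rightarrow> real) \<Rightarrow> ennreal" where
  "avg L T f = (\<integral>\<^sup>+z. ennreal (f z) \<partial>lebesgue_on (spacetime L T)) / ennreal (T * L^3)"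

definition ennpowr :: "ennreal \<Rightarrow> real \<Rightarrow> ennreal" where
  "ennpowr x a = (if x = \<infinity> then \<infinity> else ennreal (enn2real x powr a))"

primrec k_smooth :: "nat \<Rightarrow> ('a::euclidean_space \<Rightarrow> 'b::real_normed_vector) \<Rightarrow> bool" where
  "k_smooth 0 f \<longleftrightarrow> continuous_on UNIV f"
| "k_smooth (Suc k) f \<longleftrightarrow> f differentiable_on UNIV \<and>
     (\<forall>v. k_smooth k (\<lambda>x. frechet_derivative f (at x) v))"

definition smooth :: "('a::euclidean_space \<Rightarrow> 'b::real_normed_vector) \<Rightarrow> bool" where
  "smooth f \<longleftrightarrow> (\<forall>k. k_smooth k f)"

definition partial :: "3 \<Rightarrow> (real^3 \<Rightarrow> 'b::real_normed_vector) \<Rightarrow> real^3 \<Rightarrow> 'b" where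
  "partial i f x = frechet_derivative f (at x) (axis i 1)"

definition L2_field :: "real \<Rightarrow> real \<Rightarrow> (real \<times> (real^3) \<Rightarrow> real^3) \<Rightarrow> bool" where
  "L2_field L T u \<longleftrightarrow> u \<in> borel_measurable (lebesgue_on (spacetime L T)) \<and>
     integrable (lebesgue_on (spacetime L T)) (\<lambda>z. (norm (u z))\<^sup>2)"

text \<open>Test functions on the product of the open interval (0,T) with the torus.\<close>

definition test_function :: "real \<Rightarrow> real \<Rightarrow> (real \<times> (real^3) \<Rightarrow> real) \<Rightarrow> bool" where
  "test_function L T \<psi> \<longleftrightarrow> smooth \<psi> \<and>
     (\<forall>t x i. \<psi> (t, x + axis i L) = \<psi> (t, x)) \<and>
     (\<exists>a b. 0 < a \<and> b < T \<and> (\<forall>t x. t \<notin> {a..b} \<longrightarrow> \<psi> (t, x) = 0))"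

definition incompressible :: "real \<Rightarrow> real \<Rightarrow> (real \<times> (real^3) \<Rightarrow> real^3) \<Rightarrow> bool" where
  "incompressible L T u \<longleftrightarrow> (\<forall>\<psi>. test_function L T \<psi> \<longrightarrow>
     (\<integral>z. (\<Sum>i\<in>UNIV. u z $ i * partial i (\<lambda>y. \<psi> (fst z, y)) (snd z))
        \<partial>lebesgue_on (spacetime L T)) = 0)"

definition lp_cutoff :: "(real^3 \<Rightarrow> real) \<Rightarrow> bool" where
  "lp_cutoff c \<longleftrightarrow> smooth c \<and> closure {\<xi>. c \<xi> \<noteq> 0} \<subseteq> ball 0 1 \<and>
     (\<forall>\<xi>. 0 \<le> c \<xi>) \<and> (\<forall>\<xi> \<eta>. norm \<xi> = norm \<eta> \<longrightarrow> c \<xi> = c \<eta>) \<and>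
     (\<forall>\<xi>. norm \<xi> \<le> 1/2 \<longrightarrow> c \<xi> = 1)"

text \<open>Only indices \<open>q \<ge> -1\<close> are meaningful below.\<close>

definition lp_symbol :: "(real^3 \<Rightarrow> real) \<Rightarrow> real \<Rightarrow> int \<Rightarrow> real^3 \<Rightarrow> real" where
  "lp_symbol c L q \<xi> =
     (if q = -1 then c (L *\<^sub>R \<xi>)
      else let \<eta> = (L / 2 powi q) *\<^sub>R \<xi> in c (\<eta> /\<^sub>R 2) - c \<eta>)"

definition dual_lattice :: "real \<Rightarrow> (real^3) set" where
  "dual_lattice L = {k. \<forall>i. L * k $ i \<in> \<int>}"

definition fourier_coeff :: "real \<Rightarrow> (real^3 \<Rightarrow> real) \<Rightarrow> real^3 \<Rightarrow> complex" where
  "fourier_coeff L f k = complex_of_real (1 / L^3) *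
     (\<integral>x. complex_of_real (f x) * cis (- 2 * pi * (k \<bullet> x)) \<partial>lebesgue_on (torus_cell L))"

text \<open>Only finitely many k contribute to the sum. The blocks of a real field are real
  (the symbols are even), but are kept complex-valued as the formula gives them.\<close>

definition lp_block ::
  "(real^3 \<Rightarrow> real) \<Rightarrow> real \<Rightarrow> (real \<times> (real^3) \<Rightarrow> real^3) \<Rightarrow> int \<Rightarrow> real \<times> (real^3) \<Rightarrow> complex^3" where
  "lp_block c L u q z = (\<chi> j. \<Sum>\<^sub>\<infinity>k\<in>dual_lattice L.
     complex_of_real (lp_symbol c L q k) * fourier_coeff L (\<lambda>x. u (fst z, x) $ j) k *
     cis (2 * pi * (k \<bullet> snd z)))"

definition wavenumber :: "real \<Rightarrow> int \<Rightarrow> real" where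
  "wavenumber L q = 2 powi q / L"

definition tensor_grad ::
  "complex^3 \<Rightarrow> complex^3 \<Rightarrow> (real^3 \<Rightarrow> complex^3) \<Rightarrow> real^3 \<Rightarrow> complex" where
  "tensor_grad a b v x = (\<Sum>i\<in>UNIV. \<Sum>j\<in>UNIV. a $ i * b $ j * partial i (\<lambda>y. v y $ j) x)"

text \<open>The flux density is used for \<open>q \<ge> 1\<close>. Its defining series is infinite and is summed
  pointwise as an absolutely convergent (unordered) sum.\<close>

definition flux_density ::
  "(real^3 \<Rightarrow> real) \<Rightarrow> real \<Rightarrow> (real \<times> (real^3) \<Rightarrow> real^3) \<Rightarrow> int \<Rightarrow> real \<times> (real^3) \<Rightarrow> complex" where
  "flux_density c L u q z =
     (\<Sum>\<^sub>\<infinity>(p1, p2, p3)\<in>{(p1, p2, p3). p1 \<ge> q - 1 \<and> p2 \<ge> q \<and> -1 \<le> p3 \<and> p3 < q \<and> \<bar>p1 - p2\<bar> < 2}.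
        tensor_grad (lp_block c L u p1 z) (lp_block c L u p2 z)
          (\<lambda>y. lp_block c L u p3 (fst z, y)) (snd z))"

definition eps_upper ::
  "(real^3 \<Rightarrow> real) \<Rightarrow> real \<Rightarrow> real \<Rightarrow> (real \<times> (real^3) \<Rightarrow> real^3) \<Rightarrow> ennreal" where
  "eps_upper c L T u =
     (SUP q\<in>{0::int..}. ennreal (wavenumber L q) * avg L T (\<lambda>z. norm (lp_block c L u q z) ^ 3))"

definition eps_lower ::
  "(real^3 \<Rightarrow> real) \<Rightarrow> real \<Rightarrow> real \<Rightarrow> (real \<times> (real^3) \<Rightarrow> real^3) \<Rightarrow> ennreal" where
  "eps_lower c L T u = (INF q\<in>{1::int..}. avg L T (\<lambda>z. norm (flux_density c L u q z)))"

text \<open>Moments of the blocks as real numbers. For square integrable \<open>u\<close> with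
  \<open>eps_upper c L T u < \<infinity>\<close> the averages of order 2 and 3 are finite for all \<open>q \<ge> 0\<close>,
  so the conversion loses nothing.\<close>

definition moment ::
  "(real^3 \<Rightarrow> real) \<Rightarrow> real \<Rightarrow> real \<Rightarrow> (real \<times> (real^3) \<Rightarrow> real^3) \<Rightarrow> nat \<Rightarrow> int \<Rightarrow> real" where
  "moment c L T u m q = enn2real (avg L T (\<lambda>z. norm (lp_block c L u q z) ^ m))"

definition energy_spectrum ::
  "(real^3 \<Rightarrow> real) \<Rightarrow> real \<Rightarrow> real \<Rightarrow> (real \<times> (real^3) \<Rightarrow> real^3) \<Rightarrow> int \<Rightarrow> real" where
  "energy_spectrum c L T u q = moment c L T u 2 q / wavenumber L q"

definition active_volume ::
  "(real^3 \<Rightarrow> real) \<Rightarrow> real \<Rightarrow> real \<Rightarrow> (real \<times> (real^3) \<Rightarrow> real^3) \<Rightarrow> int \<Rightarrow> real" where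
  "active_volume c L T u q = L^3 * moment c L T u 2 q ^ 3 / moment c L T u 3 q ^ 2"

definition active_dim ::
  "(real^3 \<Rightarrow> real) \<Rightarrow> real \<Rightarrow> real \<Rightarrow> (real \<times> (real^3) \<Rightarrow> real^3) \<Rightarrow> int \<Rightarrow> real" where
  "active_dim c L T u q = 3 - log 2 (L^3 / active_volume c L T u q) / of_int q"

text \<open>The factor \<open>(L \<lambda>\<^sub>p)\<close> to the power \<open>1 - D\<^sub>p/3\<close>; at \<open>p = 0\<close> the dimension is undefined and
  the factor is read as L times the active volume to the power -1/3.\<close>

definition intermittency_factor ::
  "(real^3 \<Rightarrow> real) \<Rightarrow> real \<Rightarrow> real \<Rightarrow> (real \<times> (real^3) \<Rightarrow> real^3) \<Rightarrow> int \<Rightarrow> real" where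
  "intermittency_factor c L T u p =
     (if p = 0 then L * active_volume c L T u 0 powr (-1/3)
      else (L * wavenumber L p) powr (1 - active_dim c L T u p / 3))"

definition loc_kernel :: "int \<Rightarrow> real" where
  "loc_kernel j = 2 powr (- 2 * real_of_int \<bar>j\<bar> / 3)"

text \<open>A term whose block vanishes almost everywhere is 0, because its energy factor is.
  All terms are nonnegative.\<close>

definition spectrum_sum ::
  "(real^3 \<Rightarrow> real) \<Rightarrow> real \<Rightarrow> real \<Rightarrow> (real \<times> (real^3) \<Rightarrow> real^3) \<Rightarrow> int \<Rightarrow> ennreal" where
  "spectrum_sum c L T u q = (\<Sum>p::nat. ennreal
     (loc_kernel (q - int p) powr (2/3) * wavenumber L (int p) powr (5/3) *
      intermittency_factor c L T u (int p) * energy_spectrum c L T u (int p)))"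

end

theory Submission
  imports Defs
begin

text \<open>
  Write \<open>m_p\<close> for the average of \<open>|u_p|^3\<close> and \<open>\<lambda>_p\<close> for the wavenumber. The intermittency factor is
  designed to turn second moments into third ones, and the p-th term of the spectrum sum is just
  \<open>2 powr (-4/9 |q - p|) (\<lambda>_p m_p) powr (2/3)\<close> (lemma \<open>spectrum_term_eq\<close>).
  The upper bound is then a geometric series, as each \<open>\<lambda>_p m_p\<close> is at most the upper dissipation
  rate (lemma \<open>spectrum_sum_upper\<close>).

  For the lower bound it suffices to estimate the average flux by \<open>S powr (3/2)\<close>, where S is the spectrum sum.
  Hoelder's inequality with exponents (3, 3, 3) and Bernstein's inequality bound the average of a triad
  \<open>(u_p1 \<otimes> u_p2) : \<nabla> u_p3\<close> by a constant times \<open>A_p1 A_p2 \<lambda>_p3 A_p3\<close> with \<open>A_p = m_p powr (1/3)\<close>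
  (lemma \<open>triad_majorant\<close>). Since each single term of the spectrum sum is at most S, \<open>A_p\<close> decays
  geometrically above q and \<open>\<lambda>_p A_p\<close> decays geometrically below q (lemma
  \<open>moment_le_spectrum_sum\<close>); summing the triads gives the claim (lemmas \<open>avg_flux_le\<close> and
  \<open>avg_flux_le_spectrum_sum\<close>).

  Bernstein's inequality comes from a finite identity instead of a convolution: on trigonometric
  polynomials of degree N, differentiation coincides with a finite combination of translations of total
  weight at most 2N (lemma \<open>bernstein_weights\<close>). Each translation preserves averages of periodic functions
  (lemma \<open>nn_integral_spacetime_translate\<close>), so Hoelder's inequality can be applied to the translates one by one.

  Fields are Lebesgue measurable in space-time, while blocks are built from space sections; replacing the
  field by a Borel function changes the blocks at almost no time (lemma \<open>lp_block_borel_representative\<close>).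
\<close>

section \<open>Differentiation as a finite combination of translations\<close>

lemma sum_roots_of_unity:
  fixes d :: int
  assumes "M > 0" "\<bar>d\<bar> < int M"
  shows "(\<Sum>j<M. cis (2 * pi * (real_of_int d * real j / real M))) = (if d = 0 then of_nat M else 0)"
proof (cases "d = 0")
  case False
  define z where "z = cis (2 * pi * (real_of_int d / M))"
  have pow: "cis (2 * pi * (real_of_int d * j / M)) = z ^ j" for j :: nat
    unfolding z_def Complex.DeMoivre by (rule arg_cong[where f = cis]) simp
  have "z ^ M = cis (2 * pi * d)"
    using assms by (simp add: z_def Complex.DeMoivre)
  then have zM: "z ^ M = 1"
    by (simp add: cis_multiple_2pi)
  have "z \<noteq> 1"
  proof
    assume "z = 1"
    then have "cos (2 * pi * (real_of_int d / M)) = 1"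
      by (simp add: z_def complex_eq_iff)
    then obtain n :: int where "2 * pi * (real_of_int d / M) = real_of_int n * 2 * pi"
      using cos_one_2pi_int by blast
    then have "pi * real_of_int d = pi * (real_of_int n * real M)"
      using assms by (simp add: field_simps)
    then have "real_of_int d = real_of_int (n * int M)"
      by simp
    then have "d = n * int M"
      by linarith
    with assms False show False
      by (metis abs_mult abs_of_nat dvd_imp_le_int dvd_triv_right not_less abs_abs)
  qed
  then have "(\<Sum>j<M. z ^ j) = 0"
    by (simp add: geometric_sum zM)
  then show ?thesis
    unfolding pow using False by simp
qed simp

lemma card_difference_pairs:
  fixes d :: int
  shows "card {(a, b). a < N \<and> b < N \<and> int a - int b = d} = nat (int N - \<bar>d\<bar>)"
proof (cases "d \<ge> 0")
  case True
  have "bij_betw (\<lambda>b. (b + nat d, b)) {..<nat (int N - d)}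
      {(a, b). a < N \<and> b < N \<and> int a - int b = d}"
    by (rule bij_betwI[where g = snd]) (use True in auto)
  from bij_betw_same_card[OF this] show ?thesis
    using True by simp
next
  case False
  have "bij_betw (\<lambda>a. (a, a + nat (- d))) {..<nat (int N + d)}
      {(a, b). a < N \<and> b < N \<and> int a - int b = d}"
    by (rule bij_betwI[where g = fst]) (use False in auto)
  from bij_betw_same_card[OF this] show ?thesis
    using False by simp
qed

text \<open>
  The squared modulus of the Dirichlet sum counts pairs with a given difference, so its discrete
  Fourier coefficients are the tent \<open>N - |d|\<close>. The bound on \<open>d\<close> excludes aliasing modulo M.
\<close>

lemma sum_fejer_frequency:
  fixes d :: int
  assumes "M > 0" "\<bar>d\<bar> + int N \<le> int M"
  shows "(\<Sum>j<M. of_real ((cmod (\<Sum>a<N. cis (2 * pi * (real a * real j / real M))))\<^sup>2)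
            * cis (2 * pi * (real_of_int d * real j / real M)))
         = of_nat (M * nat (int N - \<bar>d\<bar>))"
proof -
  let ?e = "\<lambda>n j. cis (2 * pi * (n * real j / real M))"
  have sq: "of_real ((cmod (\<Sum>a<N. ?e (real a) j))\<^sup>2) = (\<Sum>a<N. \<Sum>b<N. ?e (real a) j * cnj (?e (real b) j))" for j
    unfolding complex_norm_square cnj_sum sum_product ..
  have e: "?e (real a) j * cnj (?e (real b) j) * ?e d j = ?e (real_of_int (int a - int b + d)) j" for a b j
    by (simp add: cis_cnj cis_mult ring_distribs add_divide_distrib diff_divide_distrib)
  have "(\<Sum>j<M. of_real ((cmod (\<Sum>a<N. ?e (real a) j))\<^sup>2) * ?e d j)
      = (\<Sum>j<M. \<Sum>a<N. \<Sum>b<N. ?e (real_of_int (int a - int b + d)) j)"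
    by (subst sq) (simp only: sum_distrib_right e)
  also have "\<dots> = (\<Sum>a<N. \<Sum>j<M. \<Sum>b<N. ?e (real_of_int (int a - int b + d)) j)"
    by (rule sum.swap)
  also have "\<dots> = (\<Sum>a<N. \<Sum>b<N. \<Sum>j<M. ?e (real_of_int (int a - int b + d)) j)"
    by (intro sum.cong refl sum.swap)
  also have "\<dots> = (\<Sum>a<N. \<Sum>b<N. if int a - int b = - d then of_nat M else 0)"
    by (intro sum.cong refl, subst sum_roots_of_unity) (use assms in auto)
  also have "\<dots> = (\<Sum>(a,b)\<in>{..<N}\<times>{..<N}. if int a - int b = - d then of_nat M else 0)"
    by (simp add: sum.cartesian_product)
  also have "\<dots> = (\<Sum>(a,b)\<in>{(a, b). a < N \<and> b < N \<and> int a - int b = - d}. of_nat M)"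
    by (rule sum.mono_neutral_cong_right) (auto split: if_splits)
  also have "\<dots> = of_nat (M * card {(a, b). a < N \<and> b < N \<and> int a - int b = - d})"
    by (simp add: case_prod_unfold mult.commute)
  finally show ?thesis
    by (simp only: card_difference_pairs abs_minus_cancel)
qed

text \<open>
  Differentiation of trigonometric polynomials of degree at most N is a finite combination of
  translations with total weight at most 2N. This is the proof of Bernstein's inequality by the kernel
  \<open>2 N sin (N t) F_N(t)\<close>, where \<open>F_N\<close> is the Fejer kernel: multiplying \<open>F_N\<close> by \<open>sin (N t)\<close> shifts the tent
  \<open>max 0 (N - |n|)\<close> of its coefficients to \<open>N\<close> and \<open>- N\<close> with opposite signs, and the difference of the two
  tents equals \<open>n\<close> on \<open>[- N, N]\<close>. Sampling at M points replaces the integral by a finite sum, and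
  the positivity of \<open>F_N\<close> bounds the sum of the absolute values.
\<close>

lemma bernstein_weights:
  assumes "N > 0"
  obtains M :: nat and w :: "nat \<Rightarrow> real" where "M > 0" "(\<Sum>j<M. \<bar>w j\<bar>) \<le> 2 * N"
    "\<And>n::int. \<bar>n\<bar> \<le> int N \<Longrightarrow>
       (\<Sum>j<M. of_real (w j) * cis (2 * pi * (real_of_int n * real j / real M))) = \<i> * of_int n"
proof -
  \<comment> \<open>Kernel and polynomial have frequencies below 2N and at most N; sampling is exact on products of degree below M.\<close>
  define M where "M = 4 * N"
  have M: "M > 0"
    using assms by (simp add: M_def)
  let ?e = "\<lambda>n j. cis (2 * pi * (n * real j / real M))"
  define F where "F j = (cmod (\<Sum>a<N. ?e (real a) j))\<^sup>2" for j
  define w where "w j = sin (2 * pi * (real N * j / real M)) * F j * (2 / M)" for j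
  have F: "(\<Sum>j<M. of_real (F j) * ?e (real_of_int d) j) = of_nat (M * nat (int N - \<bar>d\<bar>))"
    if "\<bar>d\<bar> \<le> 2 * int N" for d :: int
    unfolding F_def by (rule sum_fejer_frequency) (use that assms in \<open>auto simp: M_def\<close>)
  have "complex_of_real (\<Sum>j<M. F j) = of_real (M * N)"
    using F[of 0] by simp
  then have F0: "(\<Sum>j<M. F j) = M * N"
    by (simp only: of_real_eq_iff)
  have Fnn: "F j \<ge> 0" for j
    by (simp add: F_def)
  have "(\<Sum>j<M. \<bar>w j\<bar>) \<le> (\<Sum>j<M. F j * (2 / M))"
  proof (rule sum_mono)
    fix j
    have "\<bar>w j\<bar> = \<bar>sin (2 * pi * (real N * j / real M))\<bar> * (F j * (2 / M))"
      using Fnn by (simp add: w_def abs_mult)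
    also have "\<dots> \<le> 1 * (F j * (2 / M))"
      by (intro mult_right_mono) (use Fnn in auto)
    finally show "\<bar>w j\<bar> \<le> F j * (2 / M)"
      by simp
  qed
  also have "\<dots> = 2 * N"
    using M by (simp only: sum_distrib_right[symmetric] F0) simp
  finally have "(\<Sum>j<M. \<bar>w j\<bar>) \<le> 2 * N" .
  moreover have "(\<Sum>j<M. of_real (w j) * ?e (real_of_int n) j) = \<i> * of_int n"
    if n: "\<bar>n\<bar> \<le> int N" for n :: int
  proof -
    have s: "of_real (sin x) = (cis x - cis (- x)) / (2 * \<i>)" for x
      by (simp add: complex_eq_iff)
    have e: "?e x j * ?e y j = ?e (x + y) j" for x y j
      by (simp add: cis_mult ring_distribs add_divide_distrib)
    have "of_real (w j) * ?e (real_of_int n) j = (of_real (F j) * ?e (real_of_int (int N + n)) j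
        - of_real (F j) * ?e (real_of_int (n - int N)) j) / (\<i> * M)" for j
    proof -
      have alg: "(a - b) / (2 * \<i>) * f * (2 / of_nat M) * c = f * (a * c - b * c) / (\<i> * of_nat M)"
        for a b c f :: complex
        using M by (simp add: field_simps)
      have m: "cis (- (2 * pi * (real N * j / real M))) = ?e (- real N) j"
        by simp
      have "of_real (w j) * ?e (real_of_int n) j =
         of_real (F j) * (?e (real N) j * ?e n j - ?e (- real N) j * ?e n j) / (\<i> * M)"
        unfolding w_def of_real_mult of_real_divide s m by (simp only: alg of_real_numeral of_real_of_nat_eq)
      then show ?thesis
        by (simp only: e) (simp add: algebra_simps)
    qed
    note terms = this
    have "(\<Sum>j<M. of_real (w j) * ?e (real_of_int n) j)
      = ((\<Sum>j<M. of_real (F j) * ?e (real_of_int (int N + n)) j)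
        - (\<Sum>j<M. of_real (F j) * ?e (real_of_int (n - int N)) j)) / (\<i> * M)"
      unfolding terms by (simp only: sum_subtractf diff_divide_distrib sum_divide_distrib)
    also have "\<dots> = (of_nat (M * nat (int N - \<bar>int N + n\<bar>)) - of_nat (M * nat (int N - \<bar>n - int N\<bar>))) / (\<i> * M)"
    proof -
      have "\<bar>int N + n\<bar> \<le> 2 * int N" "\<bar>n - int N\<bar> \<le> 2 * int N"
        using n by linarith+
      from this[THEN F] show ?thesis
        by (simp only:)
    qed
    also have "\<dots> = of_int (int (nat (int N - \<bar>int N + n\<bar>)) - int (nat (int N - \<bar>n - int N\<bar>))) / \<i>"
      using M by (simp add: field_simps)
    also have "int (nat (int N - \<bar>int N + n\<bar>)) - int (nat (int N - \<bar>n - int N\<bar>)) = - n"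
      using n by linarith
    finally show ?thesis
      by (simp add: field_simps)
  qed
  ultimately show thesis
    by (intro that[of M w]) (use M in auto)
qed

section \<open>Translation invariance over the cell\<close>

lemma nn_integral_lebesgue_on:
  fixes g :: "'a::euclidean_space \<Rightarrow> ennreal"
  assumes "S \<in> sets lebesgue"
  shows "(\<integral>\<^sup>+z. g z \<partial>lebesgue_on S) = (\<integral>\<^sup>+z. g z * indicator S z \<partial>lborel)"
  using assms by (simp add: nn_integral_restrict_space nn_integral_completion)

lemma nn_integral_lborel_translate:
  fixes g :: "'a::euclidean_space \<Rightarrow> ennreal"
  assumes [measurable]: "g \<in> borel_measurable borel"
  shows "(\<integral>\<^sup>+z. g (z + a) \<partial>lborel) = (\<integral>\<^sup>+z. g z \<partial>lborel)"
proof -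
  have "(\<integral>\<^sup>+z. g z \<partial>lborel) = (\<integral>\<^sup>+z. g z \<partial>distr lborel borel ((+) a))"
    by (simp add: lborel_distr_plus)
  also have "\<dots> = (\<integral>\<^sup>+z. g (a + z) \<partial>lborel)"
    by (rule nn_integral_distr) auto
  finally show ?thesis
    by (simp add: add.commute)
qed

lemma spacetime_eq_cbox: "spacetime L T = cbox (0, 0) (T, vec L)"
  by (simp add: spacetime_def torus_cell_def cbox_Pair_eq)

lemma sets_spacetime [measurable]: "spacetime L T \<in> sets borel" "spacetime L T \<in> sets lebesgue"
  by (simp_all add: spacetime_eq_cbox)

text \<open>
  The half-open cell is an exact fundamental domain, so that cutting it and translating the
  pieces leaves no overlaps or gaps to be discussed.
\<close>

lemma spacetime_ae_half_open:
  "AE z in lborel. z \<in> spacetime L T \<longleftrightarrow> fst z \<in> {0..T} \<and> (\<forall>j. 0 \<le> snd z $ j \<and> snd z $ j < L)"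
proof -
  have "cbox (0, 0) (T, vec L) - box (0, 0) (T, vec L) \<in> null_sets (lborel :: (real \<times> (real^3)) measure)"
    using negligible_frontier_interval[of "(0::real, 0::real^3)" "(T, vec L)"]
    by (simp add: negligible_iff_null_sets null_sets_completion_iff)
  then have "AE z in lborel. z \<notin> cbox (0, 0) (T, vec L) - box (0::real, 0::real^3) (T, vec L)"
    by (rule AE_not_in)
  then show ?thesis
    by eventually_elim
      (auto simp: spacetime_eq_cbox mem_box Basis_prod_def Basis_vec_def inner_axis
        less_imp_le inner_Pair_0 ball_Un)
qed

text \<open>
  A translation by s moves the part of the cell below \<open>L - s\<close> upwards by s; on the remaining part
  periodicity turns it into a translation by \<open>s - L\<close>. The two images tile the cell.
\<close>

lemma nn_integral_spacetime_translate:
  fixes g :: "real \<times> (real^3) \<Rightarrow> ennreal"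
  assumes g [measurable]: "g \<in> borel_measurable borel"
    and per: "\<And>z. g (z + (0, axis i L)) = g z"
    and s: "0 \<le> s" "s \<le> L"
  shows "(\<integral>\<^sup>+z. g (z + (0, axis i s)) \<partial>lebesgue_on (spacetime L T))
       = (\<integral>\<^sup>+z. g z \<partial>lebesgue_on (spacetime L T))"
proof -
  define H where "H = {z::real \<times> (real^3). fst z \<in> {0..T} \<and> (\<forall>j. 0 \<le> snd z $ j \<and> snd z $ j < L)}"
  define A where "A = {z \<in> H. snd z $ i + s < L}"
  define B where "B = {z \<in> H. snd z $ i + s \<ge> L}"
  have [measurable]: "(\<lambda>z::real \<times> (real^3). snd z $ j) \<in> borel_measurable borel"
    "(fst :: real \<times> (real^3) \<Rightarrow> real) \<in> borel_measurable borel" for j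
    by (intro borel_measurable_continuous_onI continuous_intros)+
  have "H = {z \<in> space borel. fst z \<in> {0..T}}
      \<inter> (\<Inter>j\<in>UNIV. {z \<in> space borel. 0 \<le> snd z $ j \<and> snd z $ j < L})"
    by (auto simp: H_def)
  also have "\<dots> \<in> sets borel"
    by (intro sets.Int sets.finite_INT) measurable
  finally have [measurable]: "H \<in> sets borel" .
  have [measurable]: "A \<in> sets borel" "B \<in> sets borel"
    unfolding A_def B_def by measurable
  have H: "(\<integral>\<^sup>+z. f z \<partial>lebesgue_on (spacetime L T)) = (\<integral>\<^sup>+z. f z * indicator H z \<partial>lborel)"
    for f :: "real \<times> (real^3) \<Rightarrow> ennreal"
    unfolding nn_integral_lebesgue_on[OF sets_spacetime(2)]
    by (rule nn_integral_cong_AE, use spacetime_ae_half_open[of L T] in eventually_elim)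
       (auto simp: H_def indicator_def)
  have wrap: "g (z + (0, axis i s)) = g (z + (0, axis i (s - L)))" for z
  proof -
    have "z + (0, axis i (s - L)) + (0, axis i L) = z + (0, axis i s)"
      by (auto simp: prod_eq_iff vec_eq_iff axis_def)
    then show ?thesis
      using per by metis
  qed
  have A': "indicator A (z - (0, axis i s)) + indicator B (z - (0, axis i (s - L))) = (indicator H z :: ennreal)" for z
  proof -
    have split: "(\<forall>j. P j) \<longleftrightarrow> P i \<and> (\<forall>j. j \<noteq> i \<longrightarrow> P j)" for P
      by metis
    have comp: "snd (z - (0, axis i r)) $ j = (if j = i then snd z $ i - r else snd z $ j)"
      "fst (z - (0, axis i r)) = fst z" for r j
      by (auto simp: axis_def)
    have "z - (0, axis i s) \<in> A \<longleftrightarrow> z \<in> H \<and> snd z $ i \<ge> s"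
      unfolding A_def H_def mem_Collect_eq comp
      by (subst (1 2) split) (use s in auto)
    moreover have "z - (0, axis i (s - L)) \<in> B \<longleftrightarrow> z \<in> H \<and> snd z $ i < s"
      unfolding B_def H_def mem_Collect_eq comp
      by (subst (1 2) split) (use s in auto)
    ultimately show ?thesis
      by (auto simp: indicator_def)
  qed
  have "(\<integral>\<^sup>+z. g (z + (0, axis i s)) * indicator H z \<partial>lborel)
      = (\<integral>\<^sup>+z. g (z + (0, axis i s)) * indicator A z + g (z + (0, axis i (s - L))) * indicator B z \<partial>lborel)"
    by (rule nn_integral_cong) (auto simp: A_def B_def indicator_def wrap)
  also have "\<dots> = (\<integral>\<^sup>+z. g (z + (0, axis i s)) * indicator A z \<partial>lborel)
                + (\<integral>\<^sup>+z. g (z + (0, axis i (s - L))) * indicator B z \<partial>lborel)"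
    by (rule nn_integral_add) auto
  also have "(\<integral>\<^sup>+z. g (z + (0, axis i s)) * indicator A z \<partial>lborel)
      = (\<integral>\<^sup>+z. g z * indicator A (z - (0, axis i s)) \<partial>lborel)"
    using nn_integral_lborel_translate[of "\<lambda>z. g z * indicator A (z - (0, axis i s))" "(0, axis i s)"]
    by (simp add: add_diff_cancel)
  also have "(\<integral>\<^sup>+z. g (z + (0, axis i (s - L))) * indicator B z \<partial>lborel)
      = (\<integral>\<^sup>+z. g z * indicator B (z - (0, axis i (s - L))) \<partial>lborel)"
    using nn_integral_lborel_translate[of "\<lambda>z. g z * indicator B (z - (0, axis i (s - L)))" "(0, axis i (s - L))"]
    by (simp add: add_diff_cancel)
  also have "(\<integral>\<^sup>+z. g z * indicator A (z - (0, axis i s)) \<partial>lborel)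
           + (\<integral>\<^sup>+z. g z * indicator B (z - (0, axis i (s - L))) \<partial>lborel)
      = (\<integral>\<^sup>+z. g z * indicator A (z - (0, axis i s)) + g z * indicator B (z - (0, axis i (s - L))) \<partial>lborel)"
    by (rule nn_integral_add[symmetric]) auto
  also have "\<dots> = (\<integral>\<^sup>+z. g z * indicator H z \<partial>lborel)"
    by (simp add: A' flip: distrib_left)
  finally show ?thesis
    by (simp add: H)
qed

section \<open>Hoelder's inequality for three factors\<close>

lemma young_three:
  fixes a b c :: real
  assumes "0 \<le> a" "0 \<le> b" "0 \<le> c"
  shows "a * b * c \<le> (a ^ 3 + b ^ 3 + c ^ 3) / 3"
proof -
  have "a ^ 3 + b ^ 3 + c ^ 3 - 3 * (a * b * c)
      = (a + b + c) * ((a - b)\<^sup>2 + (b - c)\<^sup>2 + (c - a)\<^sup>2) / 2"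
    by (simp add: power2_eq_square power3_eq_cube algebra_simps)
  moreover have "\<dots> \<ge> 0"
    using assms by auto
  ultimately show ?thesis
    by simp
qed

text \<open>
  Young's inequality is applied after scaling by \<open>\<alpha> > A\<close>, \<open>\<beta> > B\<close>, \<open>\<gamma> > C\<close>; the strict
  inequalities keep the scaling factors positive, and the limit covers the case of vanishing bounds.
\<close>

lemma nn_integral_Hoelder_three:
  fixes a b c :: "'a \<Rightarrow> real"
  assumes [measurable]: "a \<in> borel_measurable M" "b \<in> borel_measurable M" "c \<in> borel_measurable M"
    and nonneg: "\<And>x. 0 \<le> a x" "\<And>x. 0 \<le> b x" "\<And>x. 0 \<le> c x" "0 \<le> A" "0 \<le> B" "0 \<le> C"
    and bounds: "(\<integral>\<^sup>+x. ennreal (a x ^ 3) \<partial>M) \<le> ennreal (A ^ 3)"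
      "(\<integral>\<^sup>+x. ennreal (b x ^ 3) \<partial>M) \<le> ennreal (B ^ 3)"
      "(\<integral>\<^sup>+x. ennreal (c x ^ 3) \<partial>M) \<le> ennreal (C ^ 3)"
  shows "(\<integral>\<^sup>+x. ennreal (a x * b x * c x) \<partial>M) \<le> ennreal (A * B * C)"
proof -
  have pos: "(\<integral>\<^sup>+x. ennreal (a x * b x * c x) \<partial>M) \<le> ennreal (\<alpha> * \<beta> * \<gamma>)"
    if gt: "A < \<alpha>" "B < \<beta>" "C < \<gamma>" for \<alpha> \<beta> \<gamma> :: real
  proof -
    have p: "\<alpha> > 0" "\<beta> > 0" "\<gamma> > 0"
      using gt nonneg by linarith+
    define k where "k \<delta> = \<alpha> * \<beta> * \<gamma> / (3 * \<delta> ^ 3)" for \<delta>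
    have k: "k \<alpha> \<ge> 0" "k \<beta> \<ge> 0" "k \<gamma> \<ge> 0"
      using p by (auto simp: k_def)
    have "(\<integral>\<^sup>+x. ennreal (a x * b x * c x) \<partial>M)
       \<le> (\<integral>\<^sup>+x. ennreal (k \<alpha>) * ennreal (a x ^ 3) + ennreal (k \<beta>) * ennreal (b x ^ 3) + ennreal (k \<gamma>) * ennreal (c x ^ 3) \<partial>M)"
    proof (rule nn_integral_mono)
      fix x
      have "a x * b x * c x = \<alpha> * \<beta> * \<gamma> * ((a x / \<alpha>) * (b x / \<beta>) * (c x / \<gamma>))"
        using p by simp
      also have "\<dots> \<le> \<alpha> * \<beta> * \<gamma> * (((a x / \<alpha>) ^ 3 + (b x / \<beta>) ^ 3 + (c x / \<gamma>) ^ 3) / 3)"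
        using p nonneg by (intro mult_left_mono young_three) auto
      also have "\<dots> = k \<alpha> * a x ^ 3 + k \<beta> * b x ^ 3 + k \<gamma> * c x ^ 3"
        by (simp add: k_def power_divide add_divide_distrib ring_distribs)
      finally show "ennreal (a x * b x * c x) \<le> ennreal (k \<alpha>) * ennreal (a x ^ 3) + ennreal (k \<beta>) * ennreal (b x ^ 3) + ennreal (k \<gamma>) * ennreal (c x ^ 3)"
        using k nonneg by (simp add: ennreal_leI flip: ennreal_mult ennreal_plus)
    qed
    also have "\<dots> = ennreal (k \<alpha>) * (\<integral>\<^sup>+x. ennreal (a x ^ 3) \<partial>M) + ennreal (k \<beta>) * (\<integral>\<^sup>+x. ennreal (b x ^ 3) \<partial>M)
        + ennreal (k \<gamma>) * (\<integral>\<^sup>+x. ennreal (c x ^ 3) \<partial>M)"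
      by (simp add: nn_integral_add nn_integral_cmult)
    also have "\<dots> \<le> ennreal (k \<alpha>) * ennreal (\<alpha> ^ 3) + ennreal (k \<beta>) * ennreal (\<beta> ^ 3) + ennreal (k \<gamma>) * ennreal (\<gamma> ^ 3)"
    proof (intro add_mono mult_left_mono order_refl zero_le)
      show "(\<integral>\<^sup>+x. ennreal (a x ^ 3) \<partial>M) \<le> ennreal (\<alpha> ^ 3)"
        using bounds(1) by (rule order_trans) (use gt nonneg in \<open>auto intro!: ennreal_leI power_mono\<close>)
      show "(\<integral>\<^sup>+x. ennreal (b x ^ 3) \<partial>M) \<le> ennreal (\<beta> ^ 3)"
        using bounds(2) by (rule order_trans) (use gt nonneg in \<open>auto intro!: ennreal_leI power_mono\<close>)
      show "(\<integral>\<^sup>+x. ennreal (c x ^ 3) \<partial>M) \<le> ennreal (\<gamma> ^ 3)"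
        using bounds(3) by (rule order_trans) (use gt nonneg in \<open>auto intro!: ennreal_leI power_mono\<close>)
    qed
    also have "\<dots> = ennreal (\<alpha> * \<beta> * \<gamma>)"
      using p k by (simp add: k_def flip: ennreal_mult ennreal_plus)
    finally show ?thesis .
  qed
  have "(\<lambda>n. ennreal ((A + inverse (real (Suc n))) * (B + inverse (real (Suc n))) * (C + inverse (real (Suc n)))))
      \<longlonglongrightarrow> ennreal ((A + 0) * (B + 0) * (C + 0))"
    by (intro tendsto_ennrealI tendsto_intros LIMSEQ_inverse_real_of_nat)
  then have "(\<integral>\<^sup>+x. ennreal (a x * b x * c x) \<partial>M) \<le> ennreal ((A + 0) * (B + 0) * (C + 0))"
    by (rule LIMSEQ_le_const) (use pos in auto)
  then show ?thesis
    by simp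
qed

lemma avg_Hoelder_three:
  fixes a b c :: "real \<times> (real^3) \<Rightarrow> real"
  assumes pos: "L > 0" "T > 0"
    and m: "a \<in> borel_measurable borel" "b \<in> borel_measurable borel" "c \<in> borel_measurable borel"
    and nonneg: "\<And>x. 0 \<le> a x" "\<And>x. 0 \<le> b x" "\<And>x. 0 \<le> c x" "0 \<le> A" "0 \<le> B" "0 \<le> C"
    and bounds: "avg L T (\<lambda>z. a z ^ 3) \<le> ennreal (A ^ 3)"
      "avg L T (\<lambda>z. b z ^ 3) \<le> ennreal (B ^ 3)"
      "avg L T (\<lambda>z. c z ^ 3) \<le> ennreal (C ^ 3)"
  shows "avg L T (\<lambda>z. a z * b z * c z) \<le> ennreal (A * B * C)"
proof -
  define V where "V = T * L ^ 3"
  define r where "r = root 3 V"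
  have V: "V > 0"
    using pos by (simp add: V_def)
  have r: "r \<ge> 0" "r ^ 3 = V"
    using V by (simp_all add: r_def odd_real_root_pow)
  have avg_le: "avg L T f \<le> ennreal X \<longleftrightarrow> (\<integral>\<^sup>+z. ennreal (f z) \<partial>lebesgue_on (spacetime L T)) \<le> ennreal (X * V)"
    if "X \<ge> 0" for f X
    unfolding avg_def V_def[symmetric]
  proof (cases "\<integral>\<^sup>+z. ennreal (f z) \<partial>lebesgue_on (spacetime L T)")
    case (real r)
    then show "((\<integral>\<^sup>+z. ennreal (f z) \<partial>lebesgue_on (spacetime L T)) / ennreal V \<le> ennreal X) =
        ((\<integral>\<^sup>+z. ennreal (f z) \<partial>lebesgue_on (spacetime L T)) \<le> ennreal (X * V))"
      using V that by (simp add: divide_ennreal ennreal_le_iff pos_divide_le_eq)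
  next
    case top
    then show "((\<integral>\<^sup>+z. ennreal (f z) \<partial>lebesgue_on (spacetime L T)) / ennreal V \<le> ennreal X) =
        ((\<integral>\<^sup>+z. ennreal (f z) \<partial>lebesgue_on (spacetime L T)) \<le> ennreal (X * V))"
      using V by (simp add: ennreal_top_divide top_unique)
  qed
  have mm: "f \<in> borel_measurable (lebesgue_on (spacetime L T))" if "f \<in> borel_measurable borel" for f :: "_ \<Rightarrow> real"
    using that by (auto intro!: measurable_restrict_space1 measurable_completion)
  have "(\<integral>\<^sup>+z. ennreal (a z * b z * c z) \<partial>lebesgue_on (spacetime L T)) \<le> ennreal ((A * r) * (B * r) * (C * r))"
  proof (rule nn_integral_Hoelder_three)
    show "(\<integral>\<^sup>+z. ennreal (a z ^ 3) \<partial>lebesgue_on (spacetime L T)) \<le> ennreal ((A * r) ^ 3)"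
      using bounds(1) nonneg unfolding power_mult_distrib r(2) by (subst avg_le[symmetric]) simp_all
    show "(\<integral>\<^sup>+z. ennreal (b z ^ 3) \<partial>lebesgue_on (spacetime L T)) \<le> ennreal ((B * r) ^ 3)"
      using bounds(2) nonneg unfolding power_mult_distrib r(2) by (subst avg_le[symmetric]) simp_all
    show "(\<integral>\<^sup>+z. ennreal (c z ^ 3) \<partial>lebesgue_on (spacetime L T)) \<le> ennreal ((C * r) ^ 3)"
      using bounds(3) nonneg unfolding power_mult_distrib r(2) by (subst avg_le[symmetric]) simp_all
  qed (simp_all add: mm[OF m(1)] mm[OF m(2)] mm[OF m(3)] nonneg r(1))
  also have "(A * r) * (B * r) * (C * r) = (A * B * C) * V"
    unfolding r(2)[symmetric] by (simp add: power3_eq_cube)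
  finally show ?thesis
    by (subst avg_le) (use nonneg in simp_all)
qed

section \<open>Littlewood-Paley blocks as trigonometric polynomials\<close>

lemma has_derivative_trig_sum:
  fixes a :: "real^3 \<Rightarrow> complex"
  shows "((\<lambda>y. \<Sum>k\<in>F. a k * cis (2 * pi * (k \<bullet> y))) has_derivative
     (\<lambda>h. \<Sum>k\<in>F. (2 * pi * (k \<bullet> h)) *\<^sub>R (\<i> * (a k * cis (2 * pi * (k \<bullet> x)))))) (at x)"
proof (rule has_derivative_sum)
  fix k
  have "((\<lambda>y. 2 * pi * (k \<bullet> y)) has_derivative (\<lambda>h. 2 * pi * (k \<bullet> h))) (at x)"
    by (intro derivative_intros)
  from has_derivative_mult_right[OF has_derivative_cis[OF this], of "a k"]
  show "((\<lambda>y. a k * cis (2 * pi * (k \<bullet> y))) has_derivative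
      (\<lambda>h. (2 * pi * (k \<bullet> h)) *\<^sub>R (\<i> * (a k * cis (2 * pi * (k \<bullet> x)))))) (at x)"
    by (simp only: mult_scaleR_right mult.left_commute[of "a k" \<i>])
qed

lemma partial_trig_sum:
  fixes a :: "real^3 \<Rightarrow> complex"
  shows "partial i (\<lambda>y. \<Sum>k\<in>F. a k * cis (2 * pi * (k \<bullet> y))) x
     = (\<Sum>k\<in>F. of_real (2 * pi * k $ i) * (\<i> * (a k * cis (2 * pi * (k \<bullet> x)))))"
  unfolding partial_def
  unfolding frechet_derivative_at[OF has_derivative_trig_sum[of a F x], symmetric]
  by (simp only: inner_axis scaleR_conv_of_real) simp

text \<open>
  A mode k sees a translation by \<open>j L / M\<close> in direction i as multiplication by the sampled
  exponential of the integer frequency \<open>L k_i\<close>, to which the weights apply.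
\<close>

lemma partial_trig_sum_eq_translates:
  fixes a :: "real^3 \<Rightarrow> complex" and w :: "nat \<Rightarrow> real"
  assumes "L > 0" and F: "\<And>k. k \<in> F \<Longrightarrow> k \<in> dual_lattice L \<and> \<bar>L * k $ i\<bar> \<le> real N"
    and w: "\<And>n::int. \<bar>n\<bar> \<le> int N \<Longrightarrow>
       (\<Sum>j<M. of_real (w j) * cis (2 * pi * (real_of_int n * real j / real M))) = \<i> * of_int n"
  shows "partial i (\<lambda>y. \<Sum>k\<in>F. a k * cis (2 * pi * (k \<bullet> y))) x
     = of_real (2 * pi / L) * (\<Sum>j<M. of_real (w j) *
          (\<Sum>k\<in>F. a k * cis (2 * pi * (k \<bullet> (x + axis i (real j / real M * L))))))"
proof -
  have mode: "(\<Sum>j<M. of_real (w j) * (a k * cis (2 * pi * (k \<bullet> (x + axis i (real j / real M * L))))))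
      = of_real (L * k $ i) * (\<i> * (a k * cis (2 * pi * (k \<bullet> x))))" if kF: "k \<in> F" for k
  proof -
    obtain n :: int where n: "L * k $ i = real_of_int n"
      using F[OF kF] by (auto simp: dual_lattice_def elim: Ints_cases)
    then have "\<bar>n\<bar> \<le> int N"
      using F[OF kF] by linarith
    have "cis (2 * pi * (k \<bullet> (x + axis i (real j / real M * L))))
        = cis (2 * pi * (k \<bullet> x)) * cis (2 * pi * (real_of_int n * real j / real M))" for j
      unfolding n[symmetric] by (simp add: cis_mult inner_add_right inner_axis algebra_simps)
    then have "(\<Sum>j<M. of_real (w j) * (a k * cis (2 * pi * (k \<bullet> (x + axis i (real j / real M * L))))))
      = (a k * cis (2 * pi * (k \<bullet> x))) * (\<Sum>j<M. of_real (w j) * cis (2 * pi * (real_of_int n * real j / real M)))"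
      by (simp add: sum_distrib_left mult_ac)
    also have "\<dots> = (a k * cis (2 * pi * (k \<bullet> x))) * (\<i> * of_int n)"
      by (simp only: w[OF \<open>\<bar>n\<bar> \<le> int N\<close>])
    finally show ?thesis
      by (simp add: n mult_ac)
  qed
  have "(\<Sum>j<M. of_real (w j) * (\<Sum>k\<in>F. a k * cis (2 * pi * (k \<bullet> (x + axis i (real j / real M * L))))))
      = (\<Sum>k\<in>F. \<Sum>j<M. of_real (w j) * (a k * cis (2 * pi * (k \<bullet> (x + axis i (real j / real M * L))))))"
    by (simp only: sum_distrib_left) (rule sum.swap)
  also have "\<dots> = (\<Sum>k\<in>F. of_real (L * k $ i) * (\<i> * (a k * cis (2 * pi * (k \<bullet> x)))))"
    by (intro sum.cong refl mode)
  finally have swap: "(\<Sum>j<M. of_real (w j) * (\<Sum>k\<in>F. a k * cis (2 * pi * (k \<bullet> (x + axis i (real j / real M * L))))))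
      = (\<Sum>k\<in>F. of_real (L * k $ i) * (\<i> * (a k * cis (2 * pi * (k \<bullet> x)))))" .
  have scale: "of_real (2 * pi * k) * b = of_real (2 * pi / L) * (of_real (L * k) * b)" for k and b :: complex
    using \<open>L > 0\<close> by (simp add: field_simps)
  show ?thesis
    unfolding swap partial_trig_sum by (subst sum_distrib_left) (intro sum.cong refl scale)
qed

text \<open>
  A cube of modes containing the support of the q-th symbol, which lies in \<open>|L k| < 2^(q + 1)\<close>.
  The cube fits the use of one-dimensional Bernstein weights in each direction.
\<close>

definition block_modes :: "real \<Rightarrow> int \<Rightarrow> (real^3) set" where
  "block_modes L q = {k \<in> dual_lattice L. \<forall>i. \<bar>L * k $ i\<bar> \<le> 2 powi (q + 1)}"

lemma finite_block_modes:
  assumes "L > 0"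
  shows "finite (block_modes L q)"
proof -
  let ?N = "\<lfloor>2 powi (q + 1) :: real\<rfloor>"
  have "block_modes L q \<subseteq> (\<lambda>n. \<chi> i. real_of_int (n i) / L) ` (PiE UNIV (\<lambda>_. {- ?N..?N}))"
  proof
    fix k assume k: "k \<in> block_modes L q"
    then have "\<forall>i. \<exists>n. L * k $ i = real_of_int n"
      by (auto simp: block_modes_def dual_lattice_def Ints_def)
    then obtain n where n: "\<And>i. L * k $ i = real_of_int (n i)"
      by metis
    have "\<bar>real_of_int (n i)\<bar> \<le> 2 powi (q + 1)" for i
      using k unfolding block_modes_def n[symmetric] by blast
    then have "\<bar>n i\<bar> \<le> ?N" for i
      by (simp add: le_floor_iff)
    then have "n \<in> PiE UNIV (\<lambda>_. {- ?N..?N})"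
      by (auto simp: abs_le_iff) (metis minus_le_iff)
    moreover have "k = (\<chi> i. real_of_int (n i) / L)"
      using assms by (simp add: vec_eq_iff n[symmetric])
    ultimately show "k \<in> (\<lambda>n. \<chi> i. real_of_int (n i) / L) ` (PiE UNIV (\<lambda>_. {- ?N..?N}))"
      by blast
  qed
  then show ?thesis
    by (rule finite_subset) (auto intro!: finite_PiE)
qed

lemma lp_cutoff_eq_0:
  assumes "lp_cutoff c" "norm \<xi> \<ge> 1"
  shows "c \<xi> = 0"
proof (rule ccontr)
  assume "c \<xi> \<noteq> 0"
  then have "\<xi> \<in> closure {\<xi>. c \<xi> \<noteq> 0}"
    by (intro subsetD[OF closure_subset] CollectI)
  also have "\<dots> \<subseteq> ball 0 1"
    using assms(1) unfolding lp_cutoff_def by (elim conjE)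
  finally show False
    using assms(2) by simp
qed

lemma lp_symbol_eq_0:
  assumes c: "lp_cutoff c" and "L > 0" "q \<ge> -1" "k \<in> dual_lattice L" "k \<notin> block_modes L q"
  shows "lp_symbol c L q k = 0"
proof -
  obtain i where i: "2 powi (q + 1) < \<bar>L * k $ i\<bar>"
    using assms by (auto simp: block_modes_def not_le)
  have n: "\<bar>L * k $ i\<bar> \<le> norm (L *\<^sub>R k)"
    using component_le_norm_cart[of "L *\<^sub>R k" i] by simp
  show ?thesis
  proof (cases "q = -1")
    case True
    then show ?thesis
      using i n by (auto simp: lp_symbol_def intro!: lp_cutoff_eq_0[OF c])
  next
    case False
    define \<eta> where "\<eta> = (L / 2 powi q) *\<^sub>R k"
    have "2 * 2 powi q \<le> norm (L *\<^sub>R k)"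
      using i n by (simp add: power_int_add)
    then have "2 \<le> norm (L *\<^sub>R k) / 2 powi q"
      by (simp add: pos_le_divide_eq)
    also have "\<dots> = norm \<eta>"
      by (simp add: \<eta>_def)
    finally have "norm \<eta> \<ge> 2" .
    then have "c \<eta> = 0" "c (\<eta> /\<^sub>R 2) = 0"
      by (auto intro!: lp_cutoff_eq_0[OF c])
    then show ?thesis
      using False by (simp add: lp_symbol_def Let_def \<eta>_def)
  qed
qed

text \<open>
  Nonzero modes satisfy \<open>|L k| \<ge> 1\<close>, outside the support of the cutoff. Hence the block of index -1
  is the spatial mean, and it drops out of the flux, where low blocks occur through their gradient.
\<close>

lemma lp_symbol_low_eq_0:
  assumes c: "lp_cutoff c" and "L > 0" "k \<in> dual_lattice L" "k \<noteq> 0"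
  shows "lp_symbol c L (-1) k = 0"
proof -
  obtain i where "k $ i \<noteq> 0"
    using \<open>k \<noteq> 0\<close> by (metis vec_eq_iff zero_index)
  moreover have "L * k $ i \<in> \<int>"
    using \<open>k \<in> dual_lattice L\<close> by (simp add: dual_lattice_def)
  moreover from this obtain n :: int where n: "L * k $ i = real_of_int n"
    by (rule Ints_cases)
  ultimately have "n \<noteq> 0"
    using \<open>L > 0\<close> by (metis less_irrefl mult_eq_0_iff of_int_0)
  then have "1 \<le> \<bar>L * k $ i\<bar>"
    unfolding n by linarith
  also have "\<dots> \<le> norm (L *\<^sub>R k)"
    using component_le_norm_cart[of "L *\<^sub>R k" i] by simp
  finally show ?thesis
    by (simp add: lp_symbol_def lp_cutoff_eq_0[OF c])
qed

lemma lp_block_component: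
  assumes "lp_cutoff c" "L > 0" "q \<ge> -1"
  shows "lp_block c L u q z $ j = (\<Sum>k\<in>block_modes L q.
     complex_of_real (lp_symbol c L q k) * fourier_coeff L (\<lambda>x. u (fst z, x) $ j) k *
     cis (2 * pi * (k \<bullet> snd z)))"
proof -
  have "lp_block c L u q z $ j = (\<Sum>\<^sub>\<infinity>k\<in>block_modes L q.
     complex_of_real (lp_symbol c L q k) * fourier_coeff L (\<lambda>x. u (fst z, x) $ j) k *
     cis (2 * pi * (k \<bullet> snd z)))"
    unfolding lp_block_def vec_lambda_beta
  proof (rule infsum_cong_neutral)
    fix k assume "k \<in> dual_lattice L - block_modes L q"
    then show "complex_of_real (lp_symbol c L q k) * fourier_coeff L (\<lambda>x. u (fst z, x) $ j) k *
        cis (2 * pi * (k \<bullet> snd z)) = 0"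
      using lp_symbol_eq_0[OF assms] by simp
  qed (auto simp: block_modes_def)
  then show ?thesis
    by (simp add: finite_block_modes assms)
qed

lemma lp_block_low_const:
  assumes "lp_cutoff c" "L > 0"
  shows "lp_block c L u (-1) (t, x) = lp_block c L u (-1) (t, y)"
proof -
  have same: "complex_of_real (lp_symbol c L (-1) k) * f * cis (2 * pi * (k \<bullet> x))
      = complex_of_real (lp_symbol c L (-1) k) * f * cis (2 * pi * (k \<bullet> y))"
    if "k \<in> dual_lattice L" for k f
    using lp_symbol_low_eq_0[OF assms that] by (cases "k = 0") auto
  show ?thesis
    unfolding lp_block_def vec_eq_iff vec_lambda_beta fst_conv snd_conv
    by (intro allI infsum_cong same)
qed

lemma lp_block_periodic:
  assumes "lp_cutoff c" "L > 0" "q \<ge> -1"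
  shows "lp_block c L u q (z + (0, axis i L)) = lp_block c L u q z"
proof -
  have "cis (2 * pi * (k \<bullet> (snd z + axis i L))) = cis (2 * pi * (k \<bullet> snd z))" if "k \<in> dual_lattice L" for k
  proof -
    have "cis (2 * pi * (k \<bullet> (snd z + axis i L))) = cis (2 * pi * (k \<bullet> snd z)) * cis (2 * pi * (L * k $ i))"
      by (simp add: cis_mult inner_add_right inner_axis algebra_simps)
    also have "cis (2 * pi * (L * k $ i)) = 1"
      using that by (intro cis_multiple_2pi) (auto simp: dual_lattice_def)
    finally show ?thesis
      by simp
  qed
  then show ?thesis
    by (simp add: vec_eq_iff lp_block_component[OF assms] block_modes_def)
qed

lemma lp_block_partial_low:
  assumes "lp_cutoff c" "L > 0"
  shows "partial i (\<lambda>y. lp_block c L u (-1) (t, y) $ j) x = 0"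
proof -
  have "(\<lambda>y. lp_block c L u (-1) (t, y) $ j) = (\<lambda>y. lp_block c L u (-1) (t, x) $ j)"
    using lp_block_low_const[OF assms] by metis
  then show ?thesis
    by (simp add: partial_def frechet_derivative_const)
qed

text \<open>
  Bernstein's inequality in pointwise form: the gradient is dominated by a combination of translates of
  the block itself. The weights depend neither on the field nor on the point, so every translation
  invariant norm of the gradient costs a factor of the order of the wavenumber.
\<close>

lemma lp_block_bernstein:
  assumes "L > 0" "q \<ge> 0"
  obtains M :: nat and w :: "nat \<Rightarrow> real"
  where "M > 0" "(\<Sum>m<M. \<bar>w m\<bar>) \<le> 8 * pi * wavenumber L q"
    "\<And>c u t x i j. lp_cutoff c \<Longrightarrow>
       norm (partial i (\<lambda>y. lp_block c L u q (t, y) $ j) x)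
       \<le> (\<Sum>m<M. \<bar>w m\<bar> * norm (lp_block c L u q (t, x + axis i (real m / real M * L))))"
proof -
  define N :: nat where "N = 2 ^ nat (q + 1)"
  have N: "real N = 2 powi (q + 1)"
    using assms by (simp add: N_def power_int_def)
  obtain M :: nat and w :: "nat \<Rightarrow> real" where M: "M > 0" and w: "(\<Sum>j<M. \<bar>w j\<bar>) \<le> 2 * N"
    "\<And>n::int. \<bar>n\<bar> \<le> int N \<Longrightarrow>
       (\<Sum>j<M. of_real (w j) * cis (2 * pi * (real_of_int n * real j / real M))) = \<i> * of_int n"
    using bernstein_weights[of N] by (auto simp: N_def)
  show thesis
  proof
    show "M > 0" by fact
    have "(\<Sum>m<M. \<bar>2 * pi / L * w m\<bar>) = 2 * pi / L * (\<Sum>m<M. \<bar>w m\<bar>)"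
      using assms by (simp add: abs_mult sum_distrib_left)
    also have "\<dots> \<le> 2 * pi / L * (2 * N)"
      using w(1) assms by (intro mult_left_mono) auto
    also have "\<dots> = 8 * pi * wavenumber L q"
      using assms by (simp add: N wavenumber_def power_int_add field_simps)
    finally show "(\<Sum>m<M. \<bar>2 * pi / L * w m\<bar>) \<le> 8 * pi * wavenumber L q" .
    fix c u t x i j assume c: "lp_cutoff c"
    have q: "q \<ge> -1"
      using assms by simp
    have "partial i (\<lambda>y. lp_block c L u q (t, y) $ j) x
      = of_real (2 * pi / L) * (\<Sum>m<M. of_real (w m) * lp_block c L u q (t, x + axis i (real m / real M * L)) $ j)"
      unfolding lp_block_component[OF c \<open>L > 0\<close> q] fst_conv snd_conv
      by (rule partial_trig_sum_eq_translates[OF \<open>L > 0\<close> _ w(2)]) (auto simp: block_modes_def N)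
    also have "\<dots> = (\<Sum>m<M. of_real (2 * pi / L * w m) * lp_block c L u q (t, x + axis i (real m / real M * L)) $ j)"
      by (simp add: sum_distrib_left mult.assoc)
    finally have eq: "partial i (\<lambda>y. lp_block c L u q (t, y) $ j) x
      = (\<Sum>m<M. of_real (2 * pi / L * w m) * lp_block c L u q (t, x + axis i (real m / real M * L)) $ j)" .
    show "norm (partial i (\<lambda>y. lp_block c L u q (t, y) $ j) x) \<le>
       (\<Sum>m<M. \<bar>2 * pi / L * w m\<bar> * norm (lp_block c L u q (t, x + axis i (real m / real M * L))))"
      unfolding eq
    proof (rule sum_norm_le)
      fix m
      show "norm (of_real (2 * pi / L * w m) * lp_block c L u q (t, x + axis i (real m / real M * L)) $ j)
          \<le> \<bar>2 * pi / L * w m\<bar> * norm (lp_block c L u q (t, x + axis i (real m / real M * L)))"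
        unfolding norm_mult norm_of_real by (intro mult_left_mono Finite_Cartesian_Product.norm_nth_le abs_ge_zero)
    qed
  qed
qed

section \<open>Reduction to Borel measurable fields\<close>

lemma fourier_coeff_lebesgue:
  "fourier_coeff L f k = complex_of_real (1 / L^3) *
     (\<integral>x. indicator (torus_cell L) x *\<^sub>R (complex_of_real (f x) * cis (- 2 * pi * (k \<bullet> x))) \<partial>lebesgue)"
  unfolding fourier_coeff_def by (subst integral_restrict_space) (auto simp: torus_cell_def)

lemma continuous_on_cis_inner: "continuous_on A (\<lambda>x. cis (a * (k \<bullet> x)))"
  by (intro continuous_intros)

lemma measurable_cis_inner [measurable]: "(\<lambda>x. cis (a * (k \<bullet> x))) \<in> borel_measurable borel"
  by (intro borel_measurable_continuous_onI continuous_on_cis_inner)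

lemma fourier_coeff_cong_AE:
  assumes g: "g \<in> borel_measurable borel"
    and ae: "AE x in lborel. x \<in> torus_cell L \<longrightarrow> f x = g x"
  shows "fourier_coeff L f k = fourier_coeff L g k"
proof -
  let ?F = "\<lambda>h x. indicator (torus_cell L) x *\<^sub>R (complex_of_real (h x) * cis (- 2 * pi * (k \<bullet> x)))"
  note g [measurable]
  have cell [measurable]: "torus_cell L \<in> sets borel"
    by (simp add: torus_cell_def)
  have "?F g \<in> borel_measurable borel"
    by measurable
  then have G: "?F g \<in> borel_measurable lebesgue"
    by (intro measurable_completion) simp
  have eq: "AE x in lebesgue. ?F g x = ?F f x"
    using AE_completion[OF ae] by eventually_elim (auto simp: indicator_def)
  have "?F f \<in> borel_measurable lebesgue"
    by (rule borel_measurable_AE[OF G eq])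
  then have "(\<integral>x. ?F f x \<partial>lebesgue) = (\<integral>x. ?F g x \<partial>lebesgue)"
    by (rule integral_cong_AE[OF _ G]) (use eq in eventually_elim, metis)
  then show ?thesis
    by (simp add: fourier_coeff_lebesgue)
qed

lemma measurable_fourier_coeff:
  fixes u :: "real \<times> (real^3) \<Rightarrow> real"
  assumes u: "u \<in> borel_measurable borel"
  shows "(\<lambda>t. fourier_coeff L (\<lambda>x. u (t, x)) k) \<in> borel_measurable borel"
proof -
  note u [measurable]
  have cell [measurable]: "torus_cell L \<in> sets borel"
    by (simp add: torus_cell_def)
  let ?F = "\<lambda>t x. indicator (torus_cell L) x *\<^sub>R (complex_of_real (u (t, x)) * cis (- 2 * pi * (k \<bullet> x)))"
  have "(\<lambda>z. ?F (fst z) (snd z)) \<in> borel_measurable borel"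
    unfolding borel_prod[symmetric] using u[folded borel_prod] by measurable
  then have F: "(\<lambda>(t, x). ?F t x) \<in> borel_measurable (borel \<Otimes>\<^sub>M lborel)"
    by (simp add: case_prod_unfold borel_prod[symmetric] cong: measurable_cong_sets)
  have sec: "?F t \<in> borel_measurable borel" for t
  proof -
    have "(\<lambda>x. u (t, x)) \<in> borel_measurable borel"
      using measurable_compose[OF measurable_Pair1' u[folded borel_prod]] by simp
    then show ?thesis
      by measurable
  qed
  have "(\<lambda>t. \<integral>x. ?F t x \<partial>lborel) \<in> borel_measurable borel"
    by (rule lborel.borel_measurable_lebesgue_integral[OF F])
  moreover have "fourier_coeff L (\<lambda>x. u (t, x)) k = complex_of_real (1 / L^3) * (\<integral>x. ?F t x \<partial>lborel)" for t
    unfolding fourier_coeff_lebesgue by (subst integral_completion) (use sec in simp_all)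
  ultimately show ?thesis
    by simp
qed

lemma borel_measurable_vecI:
  fixes f :: "'a \<Rightarrow> 'b::euclidean_space ^ 'n"
  assumes "\<And>j. (\<lambda>z. f z $ j) \<in> borel_measurable M"
  shows "f \<in> borel_measurable M"
proof -
  have "(\<lambda>z. f z \<bullet> b) \<in> borel_measurable M" if "b \<in> Basis" for b
  proof -
    from that obtain j d where "b = axis j d"
      by (auto simp: Basis_vec_def)
    moreover have "(\<lambda>z. f z $ j \<bullet> d) \<in> borel_measurable M"
      by (intro borel_measurable_inner assms borel_measurable_const)
    ultimately show ?thesis
      by (simp add: inner_axis)
  qed
  then show ?thesis
    by (subst borel_measurable_euclidean_space) blast
qed

text \<open>
  Time dependence enters through Fourier coefficients, which are parameter integrals; Fubini's theorem
  gives their measurability in time for a Borel field.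
\<close>

lemma measurable_lp_block:
  assumes "lp_cutoff c" "L > 0" "q \<ge> -1" and u: "u \<in> borel_measurable borel"
  shows "lp_block c L u q \<in> borel_measurable borel"
proof -
  have [measurable]: "(\<lambda>t. fourier_coeff L (\<lambda>x. u (t, x) $ j) k) \<in> borel_measurable borel" for j k
    by (rule measurable_fourier_coeff[OF measurable_compose[OF u borel_measurable_nth]])
  have [measurable]: "(fst :: real \<times> (real^3) \<Rightarrow> real) \<in> borel_measurable borel"
    "(snd :: real \<times> (real^3) \<Rightarrow> real^3) \<in> borel_measurable borel"
    by (intro borel_measurable_continuous_onI continuous_intros)+
  have comp: "(\<lambda>z. lp_block c L u q z $ j) \<in> borel_measurable borel" for j
    unfolding lp_block_component[OF assms(1-3)] by measurable
  then show ?thesis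
    by (rule borel_measurable_vecI)
qed

lemma borel_representative:
  fixes u :: "real \<times> (real^3) \<Rightarrow> real^3"
  assumes u: "u \<in> borel_measurable (lebesgue_on (spacetime L T))"
  obtains u' where "u' \<in> borel_measurable borel"
    "AE z in lborel. z \<in> spacetime L T \<longrightarrow> u z = u' z"
proof -
  define v where "v z = (if z \<in> spacetime L T then u z else 0)" for z
  have v: "v \<in> borel_measurable lebesgue"
    unfolding v_def using u by (simp add: borel_measurable_if)
  then have "(\<lambda>z. v z $ j) \<in> borel_measurable lebesgue" for j
    by (rule measurable_compose[OF _ borel_measurable_nth])
  then have "\<exists>g\<in>borel_measurable lborel. AE z in lborel. v z $ j = g z" for j
    by (rule completion_ex_borel_measurable_real)
  then have "\<forall>j. \<exists>g. g \<in> borel_measurable lborel \<and> (AE z in lborel. v z $ j = g z)"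
    by blast
  then have "\<exists>g. \<forall>j. g j \<in> borel_measurable lborel \<and> (AE z in lborel. v z $ j = g j z)"
    by (rule choice)
  then obtain g where "\<forall>j. g j \<in> borel_measurable lborel \<and> (AE z in lborel. v z $ j = g j z)"
    by (rule exE)
  then have g: "g j \<in> borel_measurable borel" "AE z in lborel. v z $ j = g j z" for j
    by simp_all
  show thesis
  proof
    show "(\<lambda>z. \<chi> j. g j z) \<in> borel_measurable borel"
      by (rule borel_measurable_vecI) (simp add: g(1))
    have "AE z in lborel. \<forall>j\<in>UNIV. v z $ j = g j z"
      by (rule AE_finite_allI) (auto intro: g)
    then show "AE z in lborel. z \<in> spacetime L T \<longrightarrow> u z = (\<chi> j. g j z)"
      by eventually_elim (auto simp: vec_eq_iff v_def)
  qed
qed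

text \<open>
  Changing the field on a null set of space-time changes, for almost every time, only a null set of
  the corresponding space section, so all Fourier coefficients and all blocks at such a time are unchanged.
  Fields may thus be taken Borel, which avoids sections of Lebesgue measurable functions.
\<close>

lemma lp_block_borel_representative:
  fixes u :: "real \<times> (real^3) \<Rightarrow> real^3"
  assumes u: "u \<in> borel_measurable (lebesgue_on (spacetime L T))"
  obtains u' where "u' \<in> borel_measurable borel"
    "AE z in lebesgue_on (spacetime L T). \<forall>c q x. lp_block c L u q (fst z, x) = lp_block c L u' q (fst z, x)"
proof -
  obtain u' where u': "u' \<in> borel_measurable borel"
    and ae: "AE z in lborel. z \<in> spacetime L T \<longrightarrow> u z = u' z"
    using borel_representative[OF u] .
  have "AE t in lborel. AE x in lborel. (t, x) \<in> spacetime L T \<longrightarrow> u (t, x) = u' (t, x)"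
    by (rule lborel_pair.AE_pair) (unfold lborel_prod, rule ae)
  then have "AE t in lborel. t \<in> {0..T} \<longrightarrow> (\<forall>c q x. lp_block c L u q (t, x) = lp_block c L u' q (t, x))"
  proof eventually_elim
    case (elim t)
    have "fourier_coeff L (\<lambda>x. u (t, x) $ j) k = fourier_coeff L (\<lambda>x. u' (t, x) $ j) k"
      if "t \<in> {0..T}" for j k
    proof (rule fourier_coeff_cong_AE)
      show "(\<lambda>x. u' (t, x) $ j) \<in> borel_measurable borel"
      proof -
        have "(\<lambda>x. u' (t, x)) \<in> borel_measurable borel"
          using measurable_compose[OF measurable_Pair1' u'[folded borel_prod]] by simp
        then show ?thesis
          by (rule measurable_compose[OF _ borel_measurable_nth])
      qed
      show "AE x in lborel. x \<in> torus_cell L \<longrightarrow> u (t, x) $ j = u' (t, x) $ j"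
        using elim by eventually_elim (use that in \<open>auto simp: spacetime_def\<close>)
    qed
    then show ?case
      by (simp add: lp_block_def)
  qed
  then obtain N where N: "N \<in> null_sets lborel"
    "\<And>t c q x. t \<in> {0..T} \<Longrightarrow> t \<notin> N \<Longrightarrow> lp_block c L u q (t, x) = lp_block c L u' q (t, x)"
    by (auto elim!: AE_E3)
  have "N \<times> UNIV \<in> null_sets (lborel \<Otimes>\<^sub>M (lborel :: (real^3) measure))"
    using N(1) by (rule lborel.times_in_null_sets1) simp
  then have "AE z in lborel. z \<notin> N \<times> (UNIV :: (real^3) set)"
    unfolding lborel_prod by (rule AE_not_in)
  then have "AE z in lborel. z \<in> spacetime L T \<longrightarrow>
      (\<forall>c q x. lp_block c L u q (fst z, x) = lp_block c L u' q (fst z, x))"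
  proof eventually_elim
    case (elim z)
    then have "fst z \<notin> N"
      by (simp add: mem_Times_iff)
    then show ?case
      using N(2)[of "fst z"] by (simp add: spacetime_def mem_Times_iff)
  qed
  then have "AE z in lebesgue. z \<in> spacetime L T \<longrightarrow>
      (\<forall>c q x. lp_block c L u q (fst z, x) = lp_block c L u' q (fst z, x))"
    by (rule AE_completion)
  then have "AE z in lebesgue_on (spacetime L T). \<forall>c q x. lp_block c L u q (fst z, x) = lp_block c L u' q (fst z, x)"
    by (subst AE_restrict_space_iff) auto
  with u' show thesis
    by (rule that)
qed

section \<open>Averages of triads and of the flux\<close>

lemma avg_cong_AE:
  assumes "AE z in lebesgue_on (spacetime L T). f z = g z"
  shows "avg L T f = avg L T g"
  unfolding avg_def
  by (rule arg_cong[where f = "\<lambda>x. x / _"], rule nn_integral_cong_AE) (use assms in eventually_elim, simp)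

lemma measurable_lebesgue_onI:
  "f \<in> borel_measurable borel \<Longrightarrow> f \<in> borel_measurable (lebesgue_on S)"
  by (intro measurable_restrict_space1 measurable_completion) simp

lemma avg_sum:
  fixes k :: "'i \<Rightarrow> real"
  assumes meas: "\<And>i. i \<in> I \<Longrightarrow> f i \<in> borel_measurable borel"
    and nonneg: "\<And>i z. i \<in> I \<Longrightarrow> 0 \<le> f i z" "\<And>i. i \<in> I \<Longrightarrow> 0 \<le> k i"
  shows "avg L T (\<lambda>z. \<Sum>i\<in>I. k i * f i z) = (\<Sum>i\<in>I. ennreal (k i) * avg L T (f i))"
proof -
  have fm: "(\<lambda>z. ennreal (f i z)) \<in> borel_measurable (lebesgue_on (spacetime L T))" if "i \<in> I" for i
    by (intro measurable_compose[OF _ measurable_ennreal] measurable_lebesgue_onI meas that)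
  have "(\<integral>\<^sup>+z. ennreal (\<Sum>i\<in>I. k i * f i z) \<partial>lebesgue_on (spacetime L T))
      = (\<integral>\<^sup>+z. (\<Sum>i\<in>I. ennreal (k i) * ennreal (f i z)) \<partial>lebesgue_on (spacetime L T))"
    using nonneg by (intro nn_integral_cong) (simp add: ennreal_mult flip: sum_ennreal)
  also have "\<dots> = (\<Sum>i\<in>I. \<integral>\<^sup>+z. ennreal (k i) * ennreal (f i z) \<partial>lebesgue_on (spacetime L T))"
    by (rule nn_integral_sum) (intro borel_measurable_times_ennreal borel_measurable_const fm)
  also have "\<dots> = (\<Sum>i\<in>I. ennreal (k i) * (\<integral>\<^sup>+z. ennreal (f i z) \<partial>lebesgue_on (spacetime L T)))"
    by (intro sum.cong refl nn_integral_cmult fm)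
  finally show ?thesis
    by (simp add: avg_def divide_ennreal_def sum_distrib_right mult.assoc)
qed

lemma avg_translate:
  assumes f: "f \<in> borel_measurable borel" and per: "\<And>z. f (z + (0, axis i L)) = f z"
    and s: "0 \<le> s" "s \<le> L"
  shows "avg L T (\<lambda>z. f (z + (0, axis i s))) = avg L T f"
  unfolding avg_def
  by (subst nn_integral_spacetime_translate[OF measurable_compose[OF f measurable_ennreal] _ s])
     (simp_all add: per)

lemma norm_tensor_grad_le:
  assumes "\<And>i j. norm (partial i (\<lambda>y. v y $ j) x) \<le> G i"
  shows "norm (tensor_grad a b v x) \<le> 3 * (\<Sum>i\<in>UNIV. norm a * norm b * G i)"
proof -
  have "norm (tensor_grad a b v x) \<le> (\<Sum>i\<in>UNIV. \<Sum>j\<in>(UNIV::3 set). norm a * norm b * G i)"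
    unfolding tensor_grad_def
  proof (intro sum_norm_le)
    fix i j
    have "norm (a $ i) * norm (b $ j) \<le> norm a * norm b"
      by (intro mult_mono Finite_Cartesian_Product.norm_nth_le norm_ge_zero)
    then show "norm (a $ i * b $ j * partial i (\<lambda>y. v y $ j) x) \<le> norm a * norm b * G i"
      unfolding norm_mult by (rule mult_mono[OF _ assms]) simp_all
  qed
  then show ?thesis
    by (simp add: sum_distrib_left)
qed

text \<open>
  One term of the flux costs the product of the three \<open>L^3\<close> sizes and one wavenumber. Bernstein's
  inequality replaces the gradient by translates of the block; translations preserve the average of the
  cube, so Hoelder's inequality applies to each translate. A measurable majorant is produced, and not
  merely a bound on an average, since the flux sums infinitely many such terms under the integral.
\<close>

lemma triad_majorant:
  assumes c: "lp_cutoff c" and pos: "L > 0" "T > 0" and u: "u \<in> borel_measurable borel"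
    and p: "p1 \<ge> 0" "p2 \<ge> 0" "p3 \<ge> -1"
    and A: "\<And>p. p \<ge> 0 \<Longrightarrow> 0 \<le> A p" "\<And>p. p \<ge> 0 \<Longrightarrow> avg L T (\<lambda>z. norm (lp_block c L u p z) ^ 3) \<le> ennreal (A p ^ 3)"
  shows "\<exists>g. g \<in> borel_measurable borel \<and>
    (\<forall>z. norm (tensor_grad (lp_block c L u p1 z) (lp_block c L u p2 z)
          (\<lambda>y. lp_block c L u p3 (fst z, y)) (snd z)) \<le> g z) \<and>
    avg L T g \<le> ennreal (72 * pi * A p1 * A p2 * (if p3 = -1 then 0 else wavenumber L p3 * A p3))"
proof (cases "p3 = -1")
  case True
  then show ?thesis
    by (intro exI[of _ "\<lambda>_. 0"]) (simp add: tensor_grad_def lp_block_partial_low[OF c pos(1)] avg_def)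
next
  case False
  then have p3: "p3 \<ge> 0"
    using p by simp
  \<comment> \<open>8 pi from the Bernstein weights, times 9 = 3 * 3 for the indices i and j, gives the constant 72 pi.\<close>
  obtain M :: nat and w :: "nat \<Rightarrow> real" where M: "M > 0"
    and w: "(\<Sum>m<M. \<bar>w m\<bar>) \<le> 8 * pi * wavenumber L p3"
    and bern': "\<And>c u t x i j. lp_cutoff c \<Longrightarrow> norm (partial i (\<lambda>y. lp_block c L u p3 (t, y) $ j) x)
       \<le> (\<Sum>m<M. \<bar>w m\<bar> * norm (lp_block c L u p3 (t, x + axis i (real m / real M * L))))"
    by (rule lp_block_bernstein[OF pos(1) p3]) (rule that)
  note bern = bern'[OF c]
  define a where "a p z = norm (lp_block c L u p z)" for p z
  define f where "f = (\<lambda>(i, m) z. a p1 z * a p2 z * a p3 (z + (0, axis i (real m / real M * L))))"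
  define g where "g z = (\<Sum>e\<in>(UNIV :: 3 set) \<times> {..<M}. 3 * \<bar>w (snd e)\<bar> * f e z)" for z
  have a: "a p \<in> borel_measurable borel" if "p \<ge> 0" for p
    unfolding a_def using that
    by (intro measurable_compose[OF measurable_lp_block[OF c pos(1) _ u] borel_measurable_norm]) simp
  have a_shift: "(\<lambda>z. a p (z + d)) \<in> borel_measurable borel" if "p \<ge> 0" for p d
    by (rule measurable_compose[OF _ a[OF that]])
       (intro borel_measurable_continuous_onI continuous_intros)
  have f_meas: "f e \<in> borel_measurable borel" for e
    unfolding f_def case_prod_unfold by (intro borel_measurable_times a a_shift p p3)
  have f_nonneg: "0 \<le> f e z" for e z
    by (simp add: f_def a_def case_prod_unfold)
  have f_avg: "avg L T (f e) \<le> ennreal (A p1 * A p2 * A p3)" if e: "e \<in> (UNIV :: 3 set) \<times> {..<M}" for e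
  proof -
    obtain i m where im: "e = (i, m)" "m < M"
      using e by auto
    let ?s = "real m / real M * L"
    have s: "0 \<le> ?s" "?s \<le> L"
      using im pos M by (auto simp: field_simps)
    have "avg L T (\<lambda>z. a p3 (z + (0, axis i ?s)) ^ 3) = avg L T (\<lambda>z. a p3 z ^ 3)"
      by (rule avg_translate[where f = "\<lambda>z. a p3 z ^ 3"])
        (use p3 s in \<open>simp_all add: a_def lp_block_periodic[OF c pos(1)]
          borel_measurable_power[OF a[unfolded a_def]]\<close>)
    also have "\<dots> \<le> ennreal (A p3 ^ 3)"
      unfolding a_def by (rule A(2)[OF p3])
    finally have "avg L T (\<lambda>z. a p1 z * a p2 z * a p3 (z + (0, axis i ?s))) \<le> ennreal (A p1 * A p2 * A p3)"
      using A(2)[OF p(1)] A(2)[OF p(2)]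
      by (intro avg_Hoelder_three pos a a_shift p p3 A(1)) (simp_all add: a_def)
    then show ?thesis
      by (simp add: f_def im)
  qed
  show ?thesis
  proof (intro exI[of _ g] conjI allI)
    show "g \<in> borel_measurable borel"
      unfolding g_def by (intro borel_measurable_sum borel_measurable_times borel_measurable_const f_meas)
    show "norm (tensor_grad (lp_block c L u p1 z) (lp_block c L u p2 z)
          (\<lambda>y. lp_block c L u p3 (fst z, y)) (snd z)) \<le> g z" for z
    proof -
      have "norm (tensor_grad (lp_block c L u p1 z) (lp_block c L u p2 z)
          (\<lambda>y. lp_block c L u p3 (fst z, y)) (snd z))
        \<le> 3 * (\<Sum>i\<in>UNIV. a p1 z * a p2 z * (\<Sum>m<M. \<bar>w m\<bar> * a p3 (z + (0, axis i (real m / real M * L)))))"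
        unfolding a_def by (rule norm_tensor_grad_le) (use bern in \<open>simp add: plus_prod_def\<close>)
      also have "\<dots> = (\<Sum>i\<in>UNIV. \<Sum>m<M. 3 * \<bar>w m\<bar> * (a p1 z * a p2 z * a p3 (z + (0, axis i (real m / real M * L)))))"
        by (simp only: sum_distrib_left mult_ac)
      also have "\<dots> = g z"
        by (simp add: g_def f_def sum.cartesian_product case_prod_unfold)
      finally show ?thesis .
    qed
    have "avg L T g = (\<Sum>e\<in>(UNIV :: 3 set) \<times> {..<M}. ennreal (3 * \<bar>w (snd e)\<bar>) * avg L T (f e))"
      unfolding g_def by (rule avg_sum) (auto simp: f_meas f_nonneg)
    also have "\<dots> \<le> (\<Sum>e\<in>(UNIV :: 3 set) \<times> {..<M}. ennreal (3 * \<bar>w (snd e)\<bar>) * ennreal (A p1 * A p2 * A p3))"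
      by (intro sum_mono mult_left_mono f_avg) auto
    also have "\<dots> = ennreal ((\<Sum>e\<in>(UNIV :: 3 set) \<times> {..<M}. 3 * \<bar>w (snd e)\<bar>) * (A p1 * A p2 * A p3))"
      using A(1)[OF p(1)] A(1)[OF p(2)] A(1)[OF p3]
      by (simp add: sum_distrib_right ennreal_mult flip: sum_ennreal)
    also have "(\<Sum>e\<in>(UNIV :: 3 set) \<times> {..<M}. 3 * \<bar>w (snd e)\<bar>) = 9 * (\<Sum>m<M. \<bar>w m\<bar>)"
      by (simp add: sum.cartesian_product' sum_distrib_left)
    also have "ennreal (9 * (\<Sum>m<M. \<bar>w m\<bar>) * (A p1 * A p2 * A p3))
        \<le> ennreal (9 * (8 * pi * wavenumber L p3) * (A p1 * A p2 * A p3))"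
      using A(1)[OF p(1)] A(1)[OF p(2)] A(1)[OF p3] w
      by (intro ennreal_leI mult_right_mono mult_left_mono) auto
    finally show "avg L T g \<le> ennreal (72 * pi * A p1 * A p2 * (if p3 = -1 then 0 else wavenumber L p3 * A p3))"
      using False by (simp add: mult_ac)
  qed
qed

text \<open>
  The finite partial sums satisfy the bound, and it passes to the limit; a divergent unordered sum has
  the value 0.
\<close>

lemma norm_infsum_le_nn_integral:
  fixes f :: "'a \<Rightarrow> 'b::real_normed_vector"
  shows "ennreal (norm (infsum f S)) \<le> (\<integral>\<^sup>+x. ennreal (norm (f x)) \<partial>count_space S)"
proof (cases "f summable_on S")
  case True
  have fin: "ennreal (norm (sum f F)) \<le> (\<integral>\<^sup>+x. ennreal (norm (f x)) \<partial>count_space S)"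
    if F: "finite F" "F \<subseteq> S" for F
  proof -
    have "ennreal (norm (sum f F)) \<le> ennreal (\<Sum>x\<in>F. norm (f x))"
      by (intro ennreal_leI norm_sum)
    also have "\<dots> = (\<integral>\<^sup>+x. ennreal (norm (f x)) \<partial>count_space F)"
      using F by (simp add: nn_integral_count_space_finite)
    also have "\<dots> = (\<integral>\<^sup>+x. ennreal (norm (f x)) * indicator F x \<partial>count_space UNIV)"
      by (rule nn_integral_count_space_indicator) simp
    also have "\<dots> \<le> (\<integral>\<^sup>+x. ennreal (norm (f x)) * indicator S x \<partial>count_space UNIV)"
      using F by (intro nn_integral_mono) (auto simp: indicator_def)
    also have "\<dots> = (\<integral>\<^sup>+x. ennreal (norm (f x)) \<partial>count_space S)"
      by (rule nn_integral_count_space_indicator[symmetric]) simp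
    finally show ?thesis .
  qed
  have "(sum f \<longlongrightarrow> infsum f S) (finite_subsets_at_top S)"
    using True by (simp add: has_sum_infsum flip: has_sum_def)
  then have "((\<lambda>F. ennreal (norm (sum f F))) \<longlongrightarrow> ennreal (norm (infsum f S))) (finite_subsets_at_top S)"
    by (intro tendsto_ennrealI tendsto_norm)
  then show ?thesis
    by (rule tendsto_upperbound) (auto intro!: eventually_finite_subsets_at_top_weakI fin)
next
  case False
  then show ?thesis
    by (simp add: infsum_not_exists)
qed

lemma avg_norm_infsum_le:
  fixes f :: "'a \<Rightarrow> real \<times> (real^3) \<Rightarrow> 'b::real_normed_vector"
  assumes S: "countable S"
    and g: "\<And>x. x \<in> S \<Longrightarrow> g x \<in> borel_measurable borel" "\<And>x z. x \<in> S \<Longrightarrow> norm (f x z) \<le> g x z"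
      "\<And>x. x \<in> S \<Longrightarrow> avg L T (g x) \<le> G x"
    and pos: "L > 0" "T > 0"
  shows "avg L T (\<lambda>z. norm (\<Sum>\<^sub>\<infinity>x\<in>S. f x z)) \<le> (\<integral>\<^sup>+x. G x \<partial>count_space S)"
proof -
  let ?M = "lebesgue_on (spacetime L T)"
  have fm: "finite_measure ?M"
    by (rule finite_measure_lebesgue_on) (simp add: spacetime_eq_cbox)
  then have sf: "sigma_finite_measure ?M"
    by (simp add: finite_measure_def)
  interpret pair_sigma_finite "count_space S" ?M
    using S sf by (simp add: pair_sigma_finite_def sigma_finite_measure_count_space_countable)
  have meas: "(\<lambda>(x, z). ennreal (g x z)) \<in> borel_measurable (count_space S \<Otimes>\<^sub>M ?M)"
    by (rule measurable_pair_measure_countable1[OF S])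
       (simp add: measurable_compose[OF measurable_lebesgue_onI[OF g(1)] measurable_ennreal])
  have "(\<integral>\<^sup>+z. ennreal (norm (\<Sum>\<^sub>\<infinity>x\<in>S. f x z)) \<partial>?M) \<le> (\<integral>\<^sup>+z. \<integral>\<^sup>+x. ennreal (g x z) \<partial>count_space S \<partial>?M)"
    by (intro nn_integral_mono order_trans[OF norm_infsum_le_nn_integral] ennreal_leI g(2)) simp
  also have "\<dots> = (\<integral>\<^sup>+x. \<integral>\<^sup>+z. ennreal (g x z) \<partial>?M \<partial>count_space S)"
    using Fubini[OF meas] by simp
  finally have "avg L T (\<lambda>z. norm (\<Sum>\<^sub>\<infinity>x\<in>S. f x z))
      \<le> (\<integral>\<^sup>+x. \<integral>\<^sup>+z. ennreal (g x z) \<partial>?M \<partial>count_space S) / ennreal (T * L ^ 3)"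
    unfolding avg_def by (rule divide_right_mono_ennreal)
  also have "\<dots> = (\<integral>\<^sup>+x. avg L T (g x) \<partial>count_space S)"
    unfolding avg_def by (rule nn_integral_divide[symmetric]) simp
  also have "\<dots> \<le> (\<integral>\<^sup>+x. G x \<partial>count_space S)"
    by (intro nn_integral_mono g(3)) simp
  finally show ?thesis .
qed

section \<open>Summation over triads\<close>

lemma nn_integral_geometric:
  fixes r k :: real
  assumes "0 \<le> r" "r < 1" "0 \<le> k"
  shows "(\<integral>\<^sup>+n. ennreal (k * r ^ n) \<partial>count_space UNIV) = ennreal (k / (1 - r))"
proof -
  have "(\<lambda>n. k * r ^ n) sums (k * (1 / (1 - r)))"
    using assms by (intro sums_mult geometric_sums) simp
  then show ?thesis
    unfolding nn_integral_count_space_nat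
    by (subst suminf_ennreal_eq) (use assms in auto)
qed

lemma nn_integral_triple_geometric:
  fixes r C :: real and a b :: int
  assumes r: "0 \<le> r" "r < 1" and C: "0 \<le> C" and S: "S \<subseteq> {a..} \<times> {a..} \<times> {..b}"
  shows "(\<integral>\<^sup>+x. ennreal (C * (r ^ nat (fst x - a) * r ^ nat (fst (snd x) - a) * r ^ nat (b - snd (snd x))))
            \<partial>count_space S) \<le> ennreal (C / (1 - r) ^ 3)"
proof -
  define \<phi> where "\<phi> x = (nat (fst x - a), nat (fst (snd x) - a), nat (b - snd (snd x)))" for x
  define F where "F y = ennreal (C * (r ^ fst y * r ^ fst (snd y) * r ^ snd (snd y)))" for y :: "nat \<times> nat \<times> nat"
  have "inj_on \<phi> S"
  proof (rule inj_onI)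
    fix x y assume "x \<in> S" "y \<in> S" "\<phi> x = \<phi> y"
    moreover from this have "x \<in> {a..} \<times> {a..} \<times> {..b}" "y \<in> {a..} \<times> {a..} \<times> {..b}"
      using S by auto
    ultimately show "x = y"
      by (auto simp: \<phi>_def prod_eq_iff)
  qed
  then have "bij_betw \<phi> S (\<phi> ` S)"
    by (rule inj_on_imp_bij_betw)
  then have "(\<integral>\<^sup>+x. F (\<phi> x) \<partial>count_space S) = (\<integral>\<^sup>+y. F y \<partial>count_space (\<phi> ` S))"
    by (rule nn_integral_bij_count_space)
  also have "\<dots> = (\<integral>\<^sup>+y. F y * indicator (\<phi> ` S) y \<partial>count_space UNIV)"
    by (rule nn_integral_count_space_indicator) simp
  also have "\<dots> \<le> (\<integral>\<^sup>+y. F y \<partial>count_space UNIV)"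
    by (intro nn_integral_mono) (auto simp: indicator_def)
  also have "\<dots> = (\<integral>\<^sup>+i. \<integral>\<^sup>+j. \<integral>\<^sup>+n. F (i, j, n) \<partial>count_space UNIV \<partial>count_space UNIV \<partial>count_space UNIV)"
    by (subst nn_integral_fst_count_space[symmetric], subst nn_integral_fst_count_space[symmetric]) simp
  also have "\<dots> = (\<integral>\<^sup>+i. \<integral>\<^sup>+j. ennreal ((C / (1 - r) * r ^ i) * r ^ j) \<partial>count_space UNIV \<partial>count_space UNIV)"
  proof (intro nn_integral_cong)
    fix i j
    have "(\<integral>\<^sup>+n. F (i, j, n) \<partial>count_space UNIV) = (\<integral>\<^sup>+n. ennreal ((C * r ^ i * r ^ j) * r ^ n) \<partial>count_space UNIV)"
      by (simp add: F_def mult.assoc)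
    also have "\<dots> = ennreal ((C * r ^ i * r ^ j) / (1 - r))"
      by (rule nn_integral_geometric) (use r C in auto)
    finally show "(\<integral>\<^sup>+n. F (i, j, n) \<partial>count_space UNIV) = ennreal ((C / (1 - r) * r ^ i) * r ^ j)"
      by simp
  qed
  also have "\<dots> = (\<integral>\<^sup>+i. ennreal ((C / (1 - r) / (1 - r)) * r ^ i) \<partial>count_space UNIV)"
  proof (intro nn_integral_cong)
    fix i
    have "(\<integral>\<^sup>+j. ennreal ((C / (1 - r) * r ^ i) * r ^ j) \<partial>count_space UNIV) = ennreal ((C / (1 - r) * r ^ i) / (1 - r))"
      by (rule nn_integral_geometric) (use r C in auto)
    then show "(\<integral>\<^sup>+j. ennreal ((C / (1 - r) * r ^ i) * r ^ j) \<partial>count_space UNIV) = ennreal ((C / (1 - r) / (1 - r)) * r ^ i)"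
      by simp
  qed
  also have "\<dots> = ennreal (C / (1 - r) / (1 - r) / (1 - r))"
    by (rule nn_integral_geometric) (use r C in auto)
  finally show ?thesis
    by (simp add: F_def \<phi>_def power3_eq_cube)
qed

text \<open>
  The triad bound is a product of one factor for each index, and each factor decays geometrically away
  from q - 1, so the sum over triads is at most a product of three geometric series.
\<close>

lemma avg_flux_le:
  assumes c: "lp_cutoff c" and pos: "L > 0" "T > 0" and u: "u \<in> borel_measurable borel" and q: "q \<ge> 1"
    and A: "\<And>p. p \<ge> 0 \<Longrightarrow> 0 \<le> A p" "\<And>p. p \<ge> 0 \<Longrightarrow> avg L T (\<lambda>z. norm (lp_block c L u p z) ^ 3) \<le> ennreal (A p ^ 3)"
    and r: "0 \<le> r" "r < 1" and KB: "0 \<le> K" "0 \<le> B"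
    and high: "\<And>p. p \<ge> q - 1 \<Longrightarrow> A p \<le> K * r ^ nat (p - (q - 1))"
    and low: "\<And>p. 0 \<le> p \<Longrightarrow> p < q \<Longrightarrow> wavenumber L p * A p \<le> B * r ^ nat (q - 1 - p)"
  shows "avg L T (\<lambda>z. norm (flux_density c L u q z)) \<le> ennreal (72 * pi * K\<^sup>2 * B / (1 - r) ^ 3)"
proof -
  define S where "S = {(p1, p2, p3). p1 \<ge> q - 1 \<and> p2 \<ge> q \<and> -1 \<le> p3 \<and> p3 < q \<and> \<bar>p1 - p2\<bar> < 2}"
  define f where "f = (\<lambda>x z. case x of (p1, p2, p3) \<Rightarrow>
      tensor_grad (lp_block c L u p1 z) (lp_block c L u p2 z) (\<lambda>y. lp_block c L u p3 (fst z, y)) (snd z))"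
  define G where "G = (\<lambda>x. ennreal (72 * pi * K\<^sup>2 * B *
      (r ^ nat (fst x - (q - 1)) * r ^ nat (fst (snd x) - (q - 1)) * r ^ nat (q - 1 - snd (snd x)))))"
  have "\<exists>g. g \<in> borel_measurable borel \<and> (\<forall>z. norm (f x z) \<le> g z) \<and> avg L T g \<le> G x" if "x \<in> S" for x
  proof -
    obtain p1 p2 p3 where x: "x = (p1, p2, p3)"
      by (cases x) auto
    then have p: "p1 \<ge> q - 1" "p2 \<ge> q" "-1 \<le> p3" "p3 < q"
      using that by (auto simp: S_def)
    then have p0: "p1 \<ge> 0" "p2 \<ge> 0"
      using q by auto
    let ?D = "if p3 = -1 then 0 else wavenumber L p3 * A p3"
    have D: "0 \<le> ?D" "?D \<le> B * r ^ nat (q - 1 - p3)"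
      using p low[of p3] A(1)[of p3] pos KB r by (auto simp: wavenumber_def)
    have "A p1 * A p2 * ?D \<le> (K * r ^ nat (p1 - (q - 1))) * (K * r ^ nat (p2 - (q - 1))) * (B * r ^ nat (q - 1 - p3))"
      by (intro mult_mono high D mult_nonneg_nonneg A(1) p0 KB zero_le_power r) (use p in auto)
    then have "72 * pi * A p1 * A p2 * ?D \<le> 72 * pi * K\<^sup>2 * B *
        (r ^ nat (p1 - (q - 1)) * r ^ nat (p2 - (q - 1)) * r ^ nat (q - 1 - p3))"
      by (simp add: power2_eq_square mult_ac)
    then have le: "ennreal (72 * pi * A p1 * A p2 * ?D) \<le> G x"
      unfolding G_def x by (intro ennreal_leI) simp
    obtain g where "g \<in> borel_measurable borel" "\<forall>z. norm (f x z) \<le> g z"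
      "avg L T g \<le> ennreal (72 * pi * A p1 * A p2 * ?D)"
      using triad_majorant[OF c pos u p0 p(3) A] unfolding f_def x prod.case by blast
    with le show ?thesis
      by (blast intro: order_trans)
  qed
  then have "\<forall>x\<in>S. \<exists>g. g \<in> borel_measurable borel \<and> (\<forall>z. norm (f x z) \<le> g z) \<and> avg L T g \<le> G x"
    by blast
  then have "\<exists>g. \<forall>x\<in>S. g x \<in> borel_measurable borel \<and> (\<forall>z. norm (f x z) \<le> g x z) \<and> avg L T (g x) \<le> G x"
    by (rule bchoice)
  then obtain g where g: "\<forall>x\<in>S. g x \<in> borel_measurable borel \<and> (\<forall>z. norm (f x z) \<le> g x z) \<and> avg L T (g x) \<le> G x"
    by (rule exE)
  have "avg L T (\<lambda>z. norm (\<Sum>\<^sub>\<infinity>x\<in>S. f x z)) \<le> (\<integral>\<^sup>+x. G x \<partial>count_space S)"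
    by (rule avg_norm_infsum_le[where g = g]) (use g pos in auto)
  also have "\<dots> \<le> ennreal (72 * pi * K\<^sup>2 * B / (1 - r) ^ 3)"
    unfolding G_def by (rule nn_integral_triple_geometric) (use r KB in \<open>auto simp: S_def\<close>)
  finally show ?thesis
    unfolding flux_density_def f_def S_def .
qed

section \<open>Moments of the blocks\<close>

lemma wavenumber_powr:
  assumes "L > 0"
  shows "wavenumber L p = wavenumber L q * 2 powr (real_of_int (p - q))"
proof -
  have "(2::real) powr real_of_int (p - q) = 2 powi (p - q)"
    by (rule powr_real_of_int') simp_all
  moreover have "(2::real) powi p = 2 powi q * 2 powi (p - q)"
    by (simp flip: power_int_add)
  ultimately show ?thesis
    by (simp add: wavenumber_def)
qed

lemma moment_nonneg: "0 \<le> moment c L T u m p"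
  by (simp add: moment_def)

lemma moment_three:
  assumes L: "L > 0" and fin: "eps_upper c L T u < \<infinity>" and p: "p \<ge> 0"
  shows "avg L T (\<lambda>z. norm (lp_block c L u p z) ^ 3) = ennreal (moment c L T u 3 p)"
    "wavenumber L p * moment c L T u 3 p \<le> enn2real (eps_upper c L T u)"
proof -
  let ?a = "avg L T (\<lambda>z. norm (lp_block c L u p z) ^ 3)"
  have w: "wavenumber L p > 0"
    using L by (simp add: wavenumber_def)
  have le: "ennreal (wavenumber L p) * ?a \<le> eps_upper c L T u"
    unfolding eps_upper_def by (rule SUP_upper) (use p in auto)
  then have "ennreal (wavenumber L p) * ?a < top"
    using fin by (simp add: order.strict_trans1)
  then have "?a < top"
    using w by (auto simp: ennreal_mult_less_top)
  then show eq: "?a = ennreal (moment c L T u 3 p)"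
    by (simp add: moment_def)
  have "ennreal (wavenumber L p * moment c L T u 3 p) \<le> ennreal (enn2real (eps_upper c L T u))"
    using le fin w by (simp add: eq ennreal_mult moment_nonneg)
  then show "wavenumber L p * moment c L T u 3 p \<le> enn2real (eps_upper c L T u)"
    by (simp add: ennreal_le_iff)
qed

lemma avg_norm_block_power_eq_0:
  assumes "lp_cutoff c" "L > 0" "T > 0" "p \<ge> 0" "u \<in> borel_measurable borel" "n > 0"
  shows "avg L T (\<lambda>z. norm (lp_block c L u p z) ^ n) = 0
     \<longleftrightarrow> (AE z in lebesgue_on (spacetime L T). lp_block c L u p z = 0)"
proof -
  have "(\<lambda>z. norm (lp_block c L u p z)) \<in> borel_measurable borel"
    using assms by (intro measurable_compose[OF measurable_lp_block borel_measurable_norm]) auto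
  then have "(\<lambda>z. ennreal (norm (lp_block c L u p z) ^ n)) \<in> borel_measurable (lebesgue_on (spacetime L T))"
    by (intro measurable_compose[OF measurable_lebesgue_onI[OF borel_measurable_power] measurable_ennreal])
  then show ?thesis
    using assms by (simp add: avg_def ennreal_divide_eq_0_iff nn_integral_0_iff_AE)
qed

lemma avg_square_finite:
  assumes pos: "L > 0" "T > 0" and f: "f \<in> borel_measurable borel" "\<And>z. 0 \<le> f z"
    and fin: "avg L T (\<lambda>z. f z ^ 3) < \<infinity>"
  shows "avg L T (\<lambda>z. f z ^ 2) < \<infinity>"
proof -
  let ?M = "lebesgue_on (spacetime L T)"
  have V: "ennreal (T * L ^ 3) > 0" "ennreal (T * L ^ 3) < top"
    using pos by auto
  have "(\<integral>\<^sup>+z. ennreal (f z ^ 2) \<partial>?M) \<le> (\<integral>\<^sup>+z. 1 + ennreal (f z ^ 3) \<partial>?M)"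
  proof (rule nn_integral_mono)
    fix z
    have "f z ^ 2 \<le> 1 + f z ^ 3"
    proof (cases "f z \<le> 1")
      case True
      then show ?thesis
        using f(2)[of z] by (smt (verit) power_le_one zero_le_power)
    next
      case False
      then show ?thesis
        using power_increasing[of 2 3 "f z"] f(2)[of z] by linarith
    qed
    then show "ennreal (f z ^ 2) \<le> 1 + ennreal (f z ^ 3)"
      using f(2)[of z] by (simp add: ennreal_leI flip: ennreal_1 ennreal_plus)
  qed
  also have "\<dots> = emeasure ?M (space ?M) + (\<integral>\<^sup>+z. ennreal (f z ^ 3) \<partial>?M)"
    using measurable_compose[OF measurable_lebesgue_onI[OF borel_measurable_power[OF f(1)]] measurable_ennreal]
    by (simp add: nn_integral_add)
  also have "\<dots> < top"
  proof -
    have "emeasure ?M (space ?M) < top"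
      by (rule finite_measure.emeasure_finite[THEN top.not_eq_extremum[THEN iffD1], OF finite_measure_lebesgue_on])
        (simp add: spacetime_eq_cbox)
    moreover have "(\<integral>\<^sup>+z. ennreal (f z ^ 3) \<partial>?M) < top"
      using fin V by (auto simp: avg_def ennreal_divide_eq_top_iff top.not_eq_extremum[symmetric])
    ultimately show ?thesis
      by simp
  qed
  finally show ?thesis
    using V by (auto simp: avg_def ennreal_divide_eq_top_iff top.not_eq_extremum[symmetric])
qed

section \<open>The averaged spectrum\<close>

lemma moment_two_eq_0_iff_three:
  assumes c: "lp_cutoff c" and pos: "L > 0" "T > 0" and u: "u \<in> borel_measurable borel"
    and fin: "eps_upper c L T u < \<infinity>" and p: "p \<ge> 0"
  shows "moment c L T u 2 p = 0 \<longleftrightarrow> moment c L T u 3 p = 0"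
proof -
  let ?b = "\<lambda>z. norm (lp_block c L u p z)"
  have a3: "avg L T (\<lambda>z. ?b z ^ 3) = ennreal (moment c L T u 3 p)"
    by (rule moment_three(1)[OF pos(1) fin p])
  have "?b \<in> borel_measurable borel"
    using p by (intro measurable_compose[OF measurable_lp_block[OF c pos(1) _ u] borel_measurable_norm]) simp
  then have "avg L T (\<lambda>z. ?b z ^ 2) < \<infinity>"
    by (rule avg_square_finite[OF pos]) (simp_all add: a3)
  then have a2: "avg L T (\<lambda>z. ?b z ^ 2) = ennreal (moment c L T u 2 p)"
    by (simp add: moment_def)
  have "avg L T (\<lambda>z. ?b z ^ 2) = 0 \<longleftrightarrow> avg L T (\<lambda>z. ?b z ^ 3) = 0"
    unfolding avg_norm_block_power_eq_0[OF c pos p u zero_less_numeral] ..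
  then show ?thesis
    unfolding a2 a3 by (simp add: antisym_conv moment_nonneg)
qed

text \<open>
  The factor is \<open>L V powr (-1/3)\<close> for the active volume V, both at \<open>p = 0\<close> and, through the definition of the
  dimension, at \<open>p > 0\<close>. It exchanges the second moment in the energy spectrum for the third moment.
\<close>

lemma intermittency_factor_eq:
  assumes L: "L > 0" and m: "moment c L T u 2 p > 0" "moment c L T u 3 p > 0" and p: "p \<ge> 0"
  shows "intermittency_factor c L T u p = moment c L T u 3 p powr (2/3) / moment c L T u 2 p"
proof -
  define m2 m3 where "m2 = moment c L T u 2 p" and "m3 = moment c L T u 3 p"
  have pos: "m2 > 0" "m3 > 0"
    using m by (auto simp: m2_def m3_def)
  define X where "X = m3\<^sup>2 / m2 ^ 3"
  have X: "X > 0"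
    using pos by (simp add: X_def)
  have "m3\<^sup>2 powr (1/3) = m3 powr (2/3)"
    using pos by (simp add: powr_powr flip: powr_numeral)
  moreover have "(m2 ^ 3) powr (1/3) = m2"
    using pos by (simp add: powr_powr flip: powr_numeral)
  ultimately have X3: "X powr (1/3) = m3 powr (2/3) / m2"
    using pos by (simp add: X_def powr_divide)
  have V: "active_volume c L T u p = L ^ 3 / X"
    using pos by (simp add: active_volume_def X_def m2_def m3_def)
  show ?thesis
  proof (cases "p = 0")
    case True
    have "(L ^ 3 / X) powr (-1/3) = X powr (1/3) / (L ^ 3) powr (1/3)"
      using L X by (simp add: powr_divide powr_minus_divide)
    also have "(L ^ 3) powr (1/3) = L"
      using L by (simp add: powr_powr flip: powr_numeral)
    finally have "L * (L ^ 3 / X) powr (-1/3) = X powr (1/3)"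
      using L by simp
    then show ?thesis
      using True V X3 by (simp add: intermittency_factor_def m2_def m3_def)
  next
    case False
    have "L * wavenumber L p = 2 powr real_of_int p"
      using L powr_real_of_int'[of 2 p] by (simp add: wavenumber_def)
    moreover have "1 - active_dim c L T u p / 3 = log 2 X / of_int p / 3"
      using L X by (simp add: active_dim_def V field_simps)
    ultimately have "intermittency_factor c L T u p = (2 powr real_of_int p) powr (log 2 X / of_int p / 3)"
      using False by (simp add: intermittency_factor_def)
    also have "\<dots> = (2 powr log 2 X) powr (1/3)"
      using False by (simp add: powr_powr)
    also have "2 powr log 2 X = X"
      using X by simp
    finally show ?thesis
      using X3 by (simp add: m2_def m3_def)
  qed
qed

text \<open>
  When the block vanishes almost everywhere, both sides are 0 although the volume is a quotient 0/0;
  this is where the two moments have to vanish together.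
\<close>

lemma spectrum_term_eq:
  assumes c: "lp_cutoff c" and pos: "L > 0" "T > 0" and u: "u \<in> borel_measurable borel"
    and fin: "eps_upper c L T u < \<infinity>" and p: "p \<ge> 0"
  shows "loc_kernel (q - p) powr (2/3) * wavenumber L p powr (5/3) *
      intermittency_factor c L T u p * energy_spectrum c L T u p
    = 2 powr (- 4/9 * real_of_int \<bar>q - p\<bar>) * (wavenumber L p * moment c L T u 3 p) powr (2/3)"
proof (cases "moment c L T u 3 p = 0")
  case True
  then show ?thesis
    using moment_two_eq_0_iff_three[OF c pos u fin p] by (simp add: energy_spectrum_def)
next
  case False
  then have m: "moment c L T u 2 p > 0" "moment c L T u 3 p > 0"
    using moment_two_eq_0_iff_three[OF c pos u fin p] moment_nonneg[of c L T u _ p] by (simp_all add: less_le)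
  have w: "wavenumber L p > 0"
    using pos by (simp add: wavenumber_def)
  have "wavenumber L p powr (5/3) = wavenumber L p powr (2/3 + 1)"
    by simp
  also have "\<dots> = wavenumber L p powr (2/3) * wavenumber L p"
    unfolding powr_add using w by simp
  finally have w53: "wavenumber L p powr (5/3) = wavenumber L p powr (2/3) * wavenumber L p" .
  have "loc_kernel (q - p) powr (2/3) = 2 powr (- 4/9 * real_of_int \<bar>q - p\<bar>)"
    by (simp add: loc_kernel_def powr_powr)
  moreover have "wavenumber L p powr (5/3) * intermittency_factor c L T u p * energy_spectrum c L T u p
      = (wavenumber L p * moment c L T u 3 p) powr (2/3)"
    unfolding intermittency_factor_eq[OF pos(1) m p] energy_spectrum_def w53
    using m w by (simp add: powr_mult)
  ultimately show ?thesis
    by (simp add: mult.assoc)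
qed

lemma suminf_two_sided_geometric:
  fixes \<rho> :: real and q :: int
  assumes \<rho>: "0 \<le> \<rho>" "\<rho> < 1" and q: "q \<ge> 0"
  shows "(\<Sum>p::nat. ennreal (\<rho> ^ nat \<bar>q - int p\<bar>)) \<le> ennreal (2 / (1 - \<rho>))"
proof -
  define k where "k = nat q"
  have geo: "(\<Sum>n. ennreal (\<rho> ^ n)) = ennreal (1 / (1 - \<rho>))"
    by (rule suminf_ennreal_eq) (use \<rho> geometric_sums[of \<rho>] in auto)
  \<comment> \<open>The series is cut at q into two one-sided geometric series.\<close>
  have "(\<Sum>p::nat. ennreal (\<rho> ^ nat \<bar>q - int p\<bar>))
      = (\<Sum>n. ennreal (\<rho> ^ nat \<bar>q - int (n + k)\<bar>)) + (\<Sum>i<k. ennreal (\<rho> ^ nat \<bar>q - int i\<bar>))"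
    by (rule suminf_offset) simp
  also have "(\<Sum>n. ennreal (\<rho> ^ nat \<bar>q - int (n + k)\<bar>)) = ennreal (1 / (1 - \<rho>))"
    using q by (simp add: k_def geo)
  also have "(\<Sum>i<k. ennreal (\<rho> ^ nat \<bar>q - int i\<bar>)) = (\<Sum>i<k. ennreal (\<rho> ^ Suc (k - Suc i)))"
    using q by (intro sum.cong refl arg_cong[where f = ennreal] arg_cong[where f = "\<lambda>n. \<rho> ^ n"]) (auto simp: k_def)
  also have "\<dots> = (\<Sum>i<k. ennreal (\<rho> ^ Suc i))"
    by (rule sum.nat_diff_reindex)
  also have "\<dots> \<le> (\<Sum>i<k. ennreal (\<rho> ^ i))"
    using \<rho> by (intro sum_mono ennreal_leI power_decreasing) auto
  also have "\<dots> \<le> (\<Sum>i. ennreal (\<rho> ^ i))"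
    by (rule sum_le_suminf) auto
  also have "\<dots> = ennreal (1 / (1 - \<rho>))"
    by (rule geo)
  also have "ennreal (1 / (1 - \<rho>)) + ennreal (1 / (1 - \<rho>)) = ennreal (2 / (1 - \<rho>))"
    using \<rho> by (simp flip: ennreal_plus)
  finally show ?thesis
    by (simp add: add_left_mono)
qed

lemma spectrum_sum_upper:
  assumes c: "lp_cutoff c" and pos: "L > 0" "T > 0" and u: "u \<in> borel_measurable borel"
    and fin: "eps_upper c L T u < \<infinity>" and q: "q \<ge> 0"
  shows "spectrum_sum c L T u q \<le> ennreal (2 / (1 - 2 powr (-4/9))) * ennpowr (eps_upper c L T u) (2/3)"
proof -
  define e where "e = enn2real (eps_upper c L T u)"
  let ?r = "2 powr (-4/9) :: real"
  have pow: "2 powr (- 4/9 * real_of_int \<bar>q - int p\<bar>) = ?r ^ nat \<bar>q - int p\<bar>" for p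
    by (simp add: powr_power mult.commute)
  have r1: "?r < 1"
    by (simp add: powr_less_one)
  have "spectrum_sum c L T u q
      = (\<Sum>p::nat. ennreal (?r ^ nat \<bar>q - int p\<bar> * (wavenumber L (int p) * moment c L T u 3 (int p)) powr (2/3)))"
    unfolding spectrum_sum_def by (simp only: spectrum_term_eq[OF c pos u fin] of_nat_0_le_iff pow)
  also have "\<dots> \<le> (\<Sum>p::nat. ennreal (?r ^ nat \<bar>q - int p\<bar>) * ennreal (e powr (2/3)))"
  proof (rule suminf_le)
    fix p :: nat
    have "(wavenumber L (int p) * moment c L T u 3 (int p)) powr (2/3) \<le> e powr (2/3)"
      using pos moment_three(2)[OF pos(1) fin, of "int p"]
      by (intro powr_mono2) (auto simp: e_def wavenumber_def moment_nonneg)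
    then show "ennreal (?r ^ nat \<bar>q - int p\<bar> * (wavenumber L (int p) * moment c L T u 3 (int p)) powr (2/3))
        \<le> ennreal (?r ^ nat \<bar>q - int p\<bar>) * ennreal (e powr (2/3))"
      by (simp add: ennreal_leI mult_left_mono flip: ennreal_mult)
  qed simp_all
  also have "\<dots> = (\<Sum>p::nat. ennreal (?r ^ nat \<bar>q - int p\<bar>)) * ennreal (e powr (2/3))"
    by (rule ennreal_suminf_multc)
  also have "\<dots> \<le> ennreal (2 / (1 - ?r)) * ennreal (e powr (2/3))"
    by (intro mult_right_mono suminf_two_sided_geometric) (use r1 q in auto)
  also have "ennreal (e powr (2/3)) = ennpowr (eps_upper c L T u) (2/3)"
    using fin by (simp add: ennpowr_def e_def)
  finally show ?thesis .
qed

text \<open>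
  A single term of the series is at most the sum. The kernel costs the factor \<open>2 powr (2/3 |q - p|)\<close>, which grows
  slowly enough to be beaten by the powers of the wavenumber in the flux.
\<close>

lemma moment_le_spectrum_sum:
  assumes c: "lp_cutoff c" and pos: "L > 0" "T > 0" and u: "u \<in> borel_measurable borel"
    and fin: "eps_upper c L T u < \<infinity>" and p: "p \<ge> 0"
    and S: "spectrum_sum c L T u q = ennreal S" "S \<ge> 0"
  shows "wavenumber L p * moment c L T u 3 p \<le> S powr (3/2) * 2 powr (2/3 * real_of_int \<bar>q - p\<bar>)"
proof -
  define X where "X = wavenumber L p * moment c L T u 3 p"
  define d where "d = real_of_int \<bar>q - p\<bar>"
  have X: "X \<ge> 0"
    using pos by (simp add: X_def wavenumber_def moment_nonneg)
  let ?t = "\<lambda>p. ennreal (loc_kernel (q - int p) powr (2/3) * wavenumber L (int p) powr (5/3) *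
      intermittency_factor c L T u (int p) * energy_spectrum c L T u (int p))"
  have "(\<Sum>i\<in>{nat p}. ?t i) \<le> (\<Sum>i. ?t i)"
    by (rule sum_le_suminf) auto
  then have "ennreal (2 powr (- 4/9 * d) * X powr (2/3)) \<le> ennreal S"
    using p unfolding spectrum_sum_def[symmetric] S(1)
    by (simp only: sum.insert sum.empty finite.emptyI empty_iff not_False_eq_True add_0_right nat_0_le
        spectrum_term_eq[OF c pos u fin] X_def d_def)
  then have "2 powr (- 4/9 * d) * X powr (2/3) \<le> S"
    using S(2) by (simp add: ennreal_le_iff)
  then have "X powr (2/3) \<le> S * 2 powr (4/9 * d)"
    by (simp add: powr_minus field_simps)
  then have "(X powr (2/3)) powr (3/2) \<le> (S * 2 powr (4/9 * d)) powr (3/2)"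
    by (intro powr_mono2) auto
  also have "\<dots> = S powr (3/2) * 2 powr (2/3 * d)"
    using S(2) by (simp add: powr_mult powr_powr)
  finally show ?thesis
    using X by (simp add: powr_powr X_def d_def)
qed

section \<open>The two-sided bound\<close>

text \<open>
  With \<open>\<sigma> = S powr (1/2)\<close> and l the wavenumber of index q, the single-term bound gives, up to a factor 2,
  \<open>A p \<le> \<sigma> l powr (-1/3) 2 powr (-(p - q)/9)\<close> for \<open>p \<ge> q - 1\<close>, because \<open>2/9 - 1/3 = -1/9\<close>, and
  \<open>wavenumber L p * A p \<le> \<sigma> l powr (2/3) 2 powr (-4(q - p)/9)\<close> for \<open>p < q\<close>, because \<open>2/9 - 2/3 = -4/9\<close>.
  Both decay, and the powers of l cancel in a triad: \<open>-1/3 - 1/3 + 2/3 = 0\<close>.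
\<close>

lemma avg_flux_le_spectrum_sum:
  assumes c: "lp_cutoff c" and pos: "L > 0" "T > 0" and u: "u \<in> borel_measurable borel"
    and fin: "eps_upper c L T u < \<infinity>" and q: "q \<ge> 1"
    and S: "spectrum_sum c L T u q = ennreal S" "S \<ge> 0"
  shows "avg L T (\<lambda>z. norm (flux_density c L u q z))
     \<le> ennreal (288 * pi / (1 - 2 powr (-1/9)) ^ 3 * S powr (3/2))"
proof -
  let ?r = "2 powr (-1/9) :: real"
  define \<sigma> where "\<sigma> = (S powr (3/2)) powr (1/3)"
  define l where "l = wavenumber L q"
  define A where "A p = moment c L T u 3 p powr (1/3)" for p
  define K where "K = 2 * (\<sigma> * l powr (-1/3))"
  define B where "B = \<sigma> * l powr (2/3)"
  have w: "wavenumber L p > 0" for p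
    using pos by (simp add: wavenumber_def)
  have l: "l > 0" and \<sigma>: "\<sigma> \<ge> 0"
    by (simp_all add: l_def w \<sigma>_def)
  have r: "?r \<ge> 0" "?r < 1"
    by (simp_all add: powr_less_one)
  have cube: "(x powr (1/3)) ^ 3 = x" if "x \<ge> 0" for x :: real
    using that by (cases "x = 0") (simp_all add: powr_power)
  have rn: "?r ^ n = 2 powr (- real n / 9)" for n
    by (simp add: powr_power mult.commute)
  have A_bound: "A p \<le> \<sigma> * l powr (-1/3) * 2 powr (2/9 * real_of_int \<bar>q - p\<bar> + real_of_int (q - p) / 3)"
    if p: "p \<ge> 0" for p
  proof -
    let ?d = "real_of_int \<bar>q - p\<bar>"
    have "moment c L T u 3 p \<le> S powr (3/2) * 2 powr (2/3 * ?d) / wavenumber L p"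
      using moment_le_spectrum_sum[OF c pos u fin p S] w[of p] by (simp add: pos_le_divide_eq mult.commute)
    also have "\<dots> = S powr (3/2) * (inverse l * 2 powr (2/3 * ?d + real_of_int (q - p)))"
    proof -
      have "2 powr real_of_int (q - p) = inverse (2 powr real_of_int (p - q))"
        by (simp flip: powr_minus)
      then show ?thesis
        unfolding wavenumber_powr[OF pos(1), of p q] l_def[symmetric] powr_add
        by (simp only: divide_inverse inverse_mult_distrib mult_ac)
    qed
    finally have m: "moment c L T u 3 p \<le> S powr (3/2) * (inverse l * 2 powr (2/3 * ?d + real_of_int (q - p)))" .
    have "A p \<le> (S powr (3/2) * (inverse l * 2 powr (2/3 * ?d + real_of_int (q - p)))) powr (1/3)"
      unfolding A_def by (rule powr_mono2[OF _ moment_nonneg m]) simp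
    also have "\<dots> = \<sigma> * (inverse l powr (1/3) * 2 powr ((2/3 * ?d + real_of_int (q - p)) * (1/3)))"
      using l by (simp add: powr_mult powr_powr \<sigma>_def)
    also have "inverse l powr (1/3) = l powr (-1/3)"
      using l by (simp add: powr_minus inverse_powr)
    also have "(2/3 * ?d + real_of_int (q - p)) * (1/3) = 2/9 * ?d + real_of_int (q - p) / 3"
      by (simp add: field_simps)
    finally show ?thesis
      by (simp add: mult.assoc)
  qed
  have high: "A p \<le> K * ?r ^ nat (p - (q - 1))" if p: "p \<ge> q - 1" for p
  proof -
    have "A p \<le> \<sigma> * l powr (-1/3) * 2 powr (2/9 * real_of_int \<bar>q - p\<bar> + real_of_int (q - p) / 3)"
      using p q by (intro A_bound) simp
    also have "\<dots> \<le> \<sigma> * l powr (-1/3) * 2 powr (1 + - real (nat (p - (q - 1))) / 9)"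
    proof (intro mult_left_mono powr_mono)
      show "2/9 * real_of_int \<bar>q - p\<bar> + real_of_int (q - p) / 3 \<le> 1 + - real (nat (p - (q - 1))) / 9"
        \<comment> \<open>The worst case is p = q - 1, where the exponents are 5/9 and 1.\<close>
        using p by (cases "p \<ge> q") (auto simp: field_simps)
    qed (use \<sigma> in auto)
    also have "\<dots> = K * ?r ^ nat (p - (q - 1))"
      unfolding rn powr_add by (simp add: K_def)
    finally show ?thesis .
  qed
  have low: "wavenumber L p * A p \<le> B * ?r ^ nat (q - 1 - p)" if p: "0 \<le> p" "p < q" for p
  proof -
    have "wavenumber L p * A p \<le> wavenumber L p *
        (\<sigma> * l powr (-1/3) * 2 powr (2/9 * real_of_int \<bar>q - p\<bar> + real_of_int (q - p) / 3))"
      using w[of p] by (intro mult_left_mono A_bound p) simp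
    also have "\<dots> = \<sigma> * (l * l powr (-1/3)) *
        (2 powr (real_of_int (p - q)) * 2 powr (2/9 * real_of_int \<bar>q - p\<bar> + real_of_int (q - p) / 3))"
      unfolding wavenumber_powr[OF pos(1), of p q] l_def[symmetric] by (simp add: mult_ac)
    also have "l * l powr (-1/3) = l powr (2/3)"
      using l powr_add[of l 1 "-1/3"] by simp
    also have "2 powr (real_of_int (p - q)) * 2 powr (2/9 * real_of_int \<bar>q - p\<bar> + real_of_int (q - p) / 3)
        = 2 powr (- 4/9 * real_of_int (q - p))"
    proof -
      have "\<bar>q - p\<bar> = q - p"
        using p by simp
      then have "real_of_int (p - q) + (2/9 * real_of_int \<bar>q - p\<bar> + real_of_int (q - p) / 3)
          = - 4/9 * real_of_int (q - p)"
        by (simp add: field_simps)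
      then show ?thesis
        by (simp only: flip: powr_add)
    qed
    also have "\<sigma> * l powr (2/3) * 2 powr (- 4/9 * real_of_int (q - p))
        \<le> \<sigma> * l powr (2/3) * 2 powr (- real (nat (q - 1 - p)) / 9)"
      by (intro mult_left_mono powr_mono) (use \<sigma> p in \<open>auto simp: field_simps\<close>)
    finally show ?thesis
      unfolding rn B_def .
  qed
  have "avg L T (\<lambda>z. norm (flux_density c L u q z)) \<le> ennreal (72 * pi * K\<^sup>2 * B / (1 - ?r) ^ 3)"
  proof (rule avg_flux_le[OF c pos u q _ _ r _ _ high low])
    show "avg L T (\<lambda>z. norm (lp_block c L u p z) ^ 3) \<le> ennreal (A p ^ 3)" if "p \<ge> 0" for p
      using moment_three(1)[OF pos(1) fin that] by (simp add: A_def cube moment_nonneg)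
  qed (auto simp: A_def K_def B_def \<sigma>)
  also have "72 * pi * K\<^sup>2 * B / (1 - ?r) ^ 3 = 288 * pi / (1 - ?r) ^ 3 * S powr (3/2)"
  proof -
    have "K\<^sup>2 * B = 4 * \<sigma> ^ 3 * (l powr (-1/3) * l powr (-1/3) * l powr (2/3))"
      by (simp add: K_def B_def power2_eq_square power3_eq_cube)
    also have "l powr (-1/3) * l powr (-1/3) * l powr (2/3) = 1"
      using l by (simp flip: powr_add)
    also have "\<sigma> ^ 3 = S powr (3/2)"
      by (simp add: \<sigma>_def cube)
    finally have "K\<^sup>2 * B = 4 * S powr (3/2)"
      by simp
    then show ?thesis
      by (simp add: mult.assoc)
  qed
  finally show ?thesis .
qed

lemma ennpowr_eps_lower_le:
  assumes c: "lp_cutoff c" and pos: "L > 0" "T > 0" and u: "u \<in> borel_measurable borel"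
    and fin: "eps_upper c L T u < \<infinity>" and q: "q \<ge> 1"
  shows "ennpowr (eps_lower c L T u) (2/3)
     \<le> ennreal ((288 * pi / (1 - 2 powr (-1/9)) ^ 3) powr (2/3)) * spectrum_sum c L T u q"
proof -
  define C where "C = 288 * pi / (1 - 2 powr (-1/9)) ^ 3"
  define S where "S = enn2real (spectrum_sum c L T u q)"
  have "(2::real) powr (-1/9) < 1"
    by (simp add: powr_less_one)
  then have C: "C \<ge> 0"
    by (simp add: C_def)
  have "spectrum_sum c L T u q \<le> ennreal (2 / (1 - 2 powr (-4/9))) * ennpowr (eps_upper c L T u) (2/3)"
    using q by (intro spectrum_sum_upper[OF c pos u fin]) simp
  also have "\<dots> < top"
    using fin by (simp add: ennpowr_def ennreal_mult_less_top)
  finally have S: "spectrum_sum c L T u q = ennreal S"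
    by (simp add: S_def)
  have S0: "S \<ge> 0"
    by (simp add: S_def)
  have "eps_lower c L T u \<le> avg L T (\<lambda>z. norm (flux_density c L u q z))"
    unfolding eps_lower_def by (rule INF_lower) (use q in simp)
  also have "\<dots> \<le> ennreal (C * S powr (3/2))"
    unfolding C_def by (rule avg_flux_le_spectrum_sum[OF c pos u fin q S S0])
  finally have le: "eps_lower c L T u \<le> ennreal (C * S powr (3/2))" .
  then have "eps_lower c L T u \<noteq> \<infinity>"
    by (auto simp: top_unique)
  have "enn2real (eps_lower c L T u) \<le> C * S powr (3/2)"
    using le C by (intro enn2real_leI) auto
  then have "enn2real (eps_lower c L T u) powr (2/3) \<le> (C * S powr (3/2)) powr (2/3)"
    by (intro powr_mono2) auto
  also have "\<dots> = C powr (2/3) * S"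
    using C S0 by (simp add: powr_mult powr_powr)
  finally show ?thesis
    using \<open>eps_lower c L T u \<noteq> \<infinity>\<close> S0
    by (simp add: ennpowr_def S C_def ennreal_leI flip: ennreal_mult)
qed

text \<open>
  The quantities in the theorem are averages of expressions in the blocks, so they do not change
  when the field is replaced by its Borel representative.
\<close>

lemma averages_borel_representative:
  fixes u :: "real \<times> (real^3) \<Rightarrow> real^3"
  assumes u: "u \<in> borel_measurable (lebesgue_on (spacetime L T))"
  obtains u' where "u' \<in> borel_measurable borel"
    "eps_upper c L T u = eps_upper c L T u'" "eps_lower c L T u = eps_lower c L T u'"
    "spectrum_sum c L T u = spectrum_sum c L T u'"
proof -
  obtain u' where u': "u' \<in> borel_measurable borel"
    and ae: "AE z in lebesgue_on (spacetime L T). \<forall>c q x. lp_block c L u q (fst z, x) = lp_block c L u' q (fst z, x)"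
    by (rule lp_block_borel_representative[OF u]) (rule that)
  have block: "AE z in lebesgue_on (spacetime L T). lp_block c L u q z = lp_block c L u' q z" for q
    using ae
  proof eventually_elim
    case (elim z)
    from elim[rule_format, of c q "snd z"] show ?case
      by simp
  qed
  have flux: "AE z in lebesgue_on (spacetime L T). flux_density c L u q z = flux_density c L u' q z" for q
    using ae
  proof eventually_elim
    case (elim z)
    have "lp_block c L u p z = lp_block c L u' p z" for p
      using elim[rule_format, of c p "snd z"] by simp
    then show ?case
      unfolding flux_density_def by (simp add: elim)
  qed
  have b: "avg L T (\<lambda>z. norm (lp_block c L u q z) ^ m) = avg L T (\<lambda>z. norm (lp_block c L u' q z) ^ m)" for q m
    by (rule avg_cong_AE) (use block[of q] in eventually_elim, simp)
  have f: "avg L T (\<lambda>z. norm (flux_density c L u q z)) = avg L T (\<lambda>z. norm (flux_density c L u' q z))" for q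
    by (rule avg_cong_AE) (use flux[of q] in eventually_elim, simp)
  have m: "moment c L T u = moment c L T u'"
    by (simp add: fun_eq_iff moment_def b)
  show thesis
  proof
    show "u' \<in> borel_measurable borel"
      by (rule u')
    show "eps_upper c L T u = eps_upper c L T u'" "eps_lower c L T u = eps_lower c L T u'"
      by (simp_all only: eps_upper_def eps_lower_def b f)
    show "spectrum_sum c L T u = spectrum_sum c L T u'"
      by (rule ext) (simp only: spectrum_sum_def intermittency_factor_def active_dim_def
          active_volume_def energy_spectrum_def m)
  qed
qed

theorem lemma4p6:
  fixes c :: "real^3 \<Rightarrow> real"
  assumes "lp_cutoff c"
  shows "\<exists>C1>0. \<exists>C2>0. \<forall>(L::real) (T::real) (u :: real \<times> (real^3) \<Rightarrow> real^3).
    L > 0 \<longrightarrow> T > 0 \<longrightarrow> L2_field L T u \<longrightarrow> incompressible L T u \<longrightarrow> eps_upper c L T u < \<infinity> \<longrightarrow>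
    (\<forall>q\<ge>1.
       ennpowr (eps_lower c L T u) (2/3) \<le> ennreal C1 * spectrum_sum c L T u q \<and>
       spectrum_sum c L T u q \<le> ennreal C2 * ennpowr (eps_upper c L T u) (2/3))"
proof (intro exI conjI allI impI)
  have r: "(2::real) powr (-1/9) < 1" "(2::real) powr (-4/9) < 1"
    by (simp_all add: powr_less_one)
  show "0 < (288 * pi / (1 - 2 powr (-1/9)) ^ 3) powr (2/3)" "0 < 2 / (1 - 2 powr (-4/9) :: real)"
    using r by simp_all
  fix L T :: real and u :: "real \<times> (real^3) \<Rightarrow> real^3" and q :: int
  assume pos: "L > 0" "T > 0" and L2: "L2_field L T u" and fin: "eps_upper c L T u < \<infinity>" and q: "1 \<le> q"
  have "u \<in> borel_measurable (lebesgue_on (spacetime L T))"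
    using L2 by (simp add: L2_field_def)
  from averages_borel_representative[OF this, of c]
  obtain u' where u': "u' \<in> borel_measurable borel"
    and eq: "eps_upper c L T u = eps_upper c L T u'" "eps_lower c L T u = eps_lower c L T u'"
      "spectrum_sum c L T u = spectrum_sum c L T u'"
    by blast
  note fin' = fin[unfolded eq]
  show "ennpowr (eps_lower c L T u) (2/3)
      \<le> ennreal ((288 * pi / (1 - 2 powr (-1/9)) ^ 3) powr (2/3)) * spectrum_sum c L T u q"
    unfolding eq by (rule ennpowr_eps_lower_le[OF assms pos u' fin' q])
  show "spectrum_sum c L T u q \<le> ennreal (2 / (1 - 2 powr (-4/9))) * ennpowr (eps_upper c L T u) (2/3)"
    unfolding eq by (rule spectrum_sum_upper[OF assms pos u' fin']) (use q in simp)
qed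

end
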